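(* The weighted Sobolev space $H^1_{w_0}(\mathbb R^2)$ embeds into the weighted Orlicz space $L_\phi(\mathbb R^2,\log(e+|x|)\,dx)$, where $\phi(t)=e^{t^2}-1$. More precisely, $$\int_{\mathbb R^2}\left(e^{\alpha u^2}-1\right)\log(e+|x|)\,dx<\infty$$ for any $u\in H^1_{w_0}(\mathbb R^2)$ and any $\alpha>0$. Moreover, the following uniform bound holds: $$\sup_{\|u\|_{w_0}^2\le 1}\int_{\mathbb R^2}\left(e^{2\pi u^2}-1\right)\log(e+|x|)\,dx<+\infty,$$ where the supremum is over $u\in H^1_{w_0}(\mathbb R^2)$.
   Context: $H^1_{w_0}(\mathbb R^2)$ is the completion of the smooth compactly supported functions on $\mathbb R^2$ with respect to the norm $$\|u\|_{w_0}^2=\int_{\mathbb R^2}|\nabla u|^2dx+\int_{\mathbb R^2}u^2\log(e+|x|)\,dx .$$ $L_\phi(\mathbb R^2,\log(e+|x|)dx)$ denotes the Orlicz space associated with the $n$-function $\phi$ and the measure $\log(e+|x|)\,dx$. *)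

theory Defs
  imports "HOL-Analysis.Analysis"
begin

type_synonym plane = "real^2"

definition partial :: "2 \<Rightarrow> (plane \<Rightarrow> real) \<Rightarrow> plane \<Rightarrow> real" where
  "partial i f x = frechet_derivative f (at x) (axis i 1)"

definition grad :: "(plane \<Rightarrow> real) \<Rightarrow> plane \<Rightarrow> plane" where
  "grad f x = (\<chi> i. partial i f x)"

primrec Ck :: "nat \<Rightarrow> (plane \<Rightarrow> real) \<Rightarrow> bool" where
  "Ck 0 f \<longleftrightarrow> continuous_on UNIV f"
| "Ck (Suc k) f \<longleftrightarrow> f differentiable_on UNIV \<and> (\<forall>i. Ck k (partial i f))"

definition Cc_infinity :: "(plane \<Rightarrow> real) set" where
  "Cc_infinity = {f. (\<forall>k. Ck k f) \<and> compact (closure {x. f x \<noteq> 0})}"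

definition w0 :: "plane \<Rightarrow> real" where
  "w0 x = ln (exp 1 + norm x)"

definition w0_norm :: "(plane \<Rightarrow> real) \<Rightarrow> real" where
  "w0_norm f = sqrt ((\<integral>x. (norm (grad f x))\<^sup>2 \<partial>lebesgue) + (\<integral>x. (f x)\<^sup>2 * w0 x \<partial>lebesgue))"

definition w0_Cauchy :: "(nat \<Rightarrow> plane \<Rightarrow> real) \<Rightarrow> bool" where
  "w0_Cauchy \<phi> \<longleftrightarrow> (\<forall>n. \<phi> n \<in> Cc_infinity) \<and>
     (\<forall>\<epsilon>>0. \<exists>N. \<forall>m\<ge>N. \<forall>n\<ge>N. w0_norm (\<lambda>x. \<phi> m x - \<phi> n x) < \<epsilon>)"

text \<open>
  An element of the completion is a class of Cauchy sequences in \<open>Cc_infinity\<close>. Such a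
  sequence is Cauchy in the complete space $L^2(w_0\,dx)$, and the class is identified with its limit
  function there. This identification is injective: see \<open>w0_approx_unique\<close> below.
\<close>

definition w0_approx :: "(nat \<Rightarrow> plane \<Rightarrow> real) \<Rightarrow> (plane \<Rightarrow> real) \<Rightarrow> bool" where
  "w0_approx \<phi> u \<longleftrightarrow> w0_Cauchy \<phi> \<and>
     (\<lambda>n. \<integral>\<^sup>+x. ennreal ((\<phi> n x - u x)\<^sup>2 * w0 x) \<partial>lebesgue) \<longlonglongrightarrow> 0"

definition H1_w0 :: "(plane \<Rightarrow> real) set" where
  "H1_w0 = {u \<in> borel_measurable lebesgue. \<exists>\<phi>. w0_approx \<phi> u}"

text \<open>
  The norm of the completion, i.e. the limit of the norms along a representing Cauchy sequence.
  It exists and does not depend on the sequence: see \<open>H1_w0_norm_tendsto\<close> below.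
\<close>

definition H1_w0_norm :: "(plane \<Rightarrow> real) \<Rightarrow> real" where
  "H1_w0_norm u = (THE r. \<exists>\<phi>. w0_approx \<phi> u \<and> (\<lambda>n. w0_norm (\<phi> n)) \<longlonglongrightarrow> r)"

definition orlicz_space :: "(real \<Rightarrow> real) \<Rightarrow> 'a measure \<Rightarrow> ('a \<Rightarrow> real) set" where
  "orlicz_space \<Phi> M =
     {u \<in> borel_measurable M. \<exists>k>0. (\<integral>\<^sup>+x. ennreal (\<Phi> (\<bar>u x\<bar> / k)) \<partial>M) < \<infinity>}"

text \<open>
  The Luxemburg norm. It is meaningful on \<open>orlicz_space \<Phi> M\<close>, where for an $n$-function \<open>\<Phi>\<close>
  the set below is nonempty.
\<close>

definition orlicz_norm :: "(real \<Rightarrow> real) \<Rightarrow> 'a measure \<Rightarrow> ('a \<Rightarrow> real) \<Rightarrow> real" where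
  "orlicz_norm \<Phi> M u = Inf {k. k > 0 \<and> (\<integral>\<^sup>+x. ennreal (\<Phi> (\<bar>u x\<bar> / k)) \<partial>M) \<le> 1}"

definition w0_measure :: "plane measure" where
  "w0_measure = density lebesgue (\<lambda>x. ennreal (w0 x))"


subsection \<open>The norm of the completion is well defined\<close>

lemma w0_ge_1: "1 \<le> w0 x"
proof -
  have "ln (exp 1) \<le> ln (exp 1 + norm x)" by (subst ln_le_cancel_iff) (auto simp: add_pos_nonneg)
  then show ?thesis by (simp add: w0_def)
qed

lemma continuous_w0: "continuous_on UNIV w0"
proof -
  have "exp 1 + norm x \<noteq> 0" for x :: plane
    using add_pos_nonneg[OF exp_gt_zero[of "1::real"] norm_ge_zero[of x]] by simp
  then show ?thesis unfolding w0_def by (intro continuous_on_ln continuous_intros) auto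
qed

lemma diff_imp_has_derivative:
  "f differentiable_on UNIV \<Longrightarrow> (f has_derivative frechet_derivative f (at x)) (at x)"
  by (simp add: differentiable_on_def frechet_derivative_works)

lemma partial_lincomb:
  fixes f g :: "plane \<Rightarrow> real"
  assumes "f differentiable_on UNIV" "g differentiable_on UNIV"
  shows "partial i (\<lambda>x. f x + c * g x) x = partial i f x + c * partial i g x"
proof -
  have "((\<lambda>x. f x + c * g x) has_derivative
      (\<lambda>h. frechet_derivative f (at x) h + c * frechet_derivative g (at x) h)) (at x)"
    using assms[THEN diff_imp_has_derivative, of x] by (auto intro!: derivative_eq_intros)
  from frechet_derivative_at[OF this] show ?thesis unfolding partial_def by metis
qed

lemma partial_mult:
  fixes f g :: "plane \<Rightarrow> real"
  assumes "f differentiable_on UNIV" "g differentiable_on UNIV"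
  shows "partial i (\<lambda>x. f x * g x) x = partial i f x * g x + f x * partial i g x"
proof -
  have "((\<lambda>x. f x * g x) has_derivative
      (\<lambda>h. frechet_derivative f (at x) h * g x + f x * frechet_derivative g (at x) h)) (at x)"
    using assms[THEN diff_imp_has_derivative, of x] by (auto intro!: derivative_eq_intros)
  from frechet_derivative_at[OF this] show ?thesis unfolding partial_def by metis
qed

lemma Ck_lincomb: "Ck k f \<Longrightarrow> Ck k g \<Longrightarrow> Ck k (\<lambda>x. f x + c * g x)"
proof (induction k arbitrary: f g)
  case 0 then show ?case by (auto intro!: continuous_intros)
next
  case (Suc k)
  have "partial i (\<lambda>x. f x + c * g x) = (\<lambda>x. partial i f x + c * partial i g x)" for i
    using Suc.prems by (auto simp: partial_lincomb)
  then show ?case using Suc by (auto intro!: derivative_intros)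
qed

lemma Cc_lincomb:
  assumes "f \<in> Cc_infinity" "g \<in> Cc_infinity"
  shows "(\<lambda>x. f x + c * g x) \<in> Cc_infinity"
proof -
  have "f x + c * g x = 0"
    if "x \<notin> closure {x. f x \<noteq> 0}" "x \<notin> closure {x. g x \<noteq> 0}" for x
  proof -
    have "f x = 0" "g x = 0"
      using that closure_subset[of "{x. f x \<noteq> 0}"] closure_subset[of "{x. g x \<noteq> 0}"] by blast+
    then show ?thesis by simp
  qed
  then have "{x. f x + c * g x \<noteq> 0} \<subseteq> closure {x. f x \<noteq> 0} \<union> closure {x. g x \<noteq> 0}" by blast
  then have "closure {x. f x + c * g x \<noteq> 0} \<subseteq> closure {x. f x \<noteq> 0} \<union> closure {x. g x \<noteq> 0}"
    by (intro closure_minimal closed_Un closed_closure)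
  moreover have "compact (closure {x. f x \<noteq> 0} \<union> closure {x. g x \<noteq> 0})"
    using assms by (auto simp: Cc_infinity_def)
  ultimately have "compact (closure {x. f x + c * g x \<noteq> 0})"
    using bounded_subset closed_closure unfolding compact_eq_bounded_closed by blast
  then show ?thesis using assms Ck_lincomb by (auto simp: Cc_infinity_def)
qed

lemma Cc_diff: "f \<in> Cc_infinity \<Longrightarrow> g \<in> Cc_infinity \<Longrightarrow> (\<lambda>x. f x - g x) \<in> Cc_infinity"
  using Cc_lincomb[of f g "-1"] by simp

lemma Cc_differentiable: "f \<in> Cc_infinity \<Longrightarrow> f differentiable_on UNIV"
  by (auto simp: Cc_infinity_def dest: spec[of _ "Suc 0"])

lemma Cc_continuous: "f \<in> Cc_infinity \<Longrightarrow> continuous_on UNIV f"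
  by (auto simp: Cc_infinity_def dest: spec[of _ 0])

lemma partial_eq_0:
  assumes "x \<notin> closure {x. f x \<noteq> 0}"
  shows "partial i f x = 0"
proof -
  have "((\<lambda>x. 0) has_derivative (\<lambda>h. 0)) (at x)" by simp
  then have "(f has_derivative (\<lambda>h. 0)) (at x)"
    by (rule has_derivative_transform_within_open[where s="- closure {x. f x \<noteq> 0}"])
       (use assms closure_subset[of "{x. f x \<noteq> 0}"] in auto)
  from frechet_derivative_at[OF this] show ?thesis unfolding partial_def by metis
qed

lemma Cc_partial:
  assumes "f \<in> Cc_infinity" shows "partial i f \<in> Cc_infinity"
proof -
  have "Ck k (partial i f)" for k
    using assms by (auto simp: Cc_infinity_def dest: spec[of _ "Suc k"])
  moreover have "closure {x. partial i f x \<noteq> 0} \<subseteq> closure {x. f x \<noteq> 0}"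
    using partial_eq_0[of _ f i] by (intro closure_minimal) auto
  then have "compact (closure {x. partial i f x \<noteq> 0})"
    using assms by (auto simp: Cc_infinity_def compact_eq_bounded_closed intro: bounded_subset)
  ultimately show ?thesis by (auto simp: Cc_infinity_def)
qed

lemma integrable_compact_support:
  fixes f :: "plane \<Rightarrow> real"
  assumes "continuous_on UNIV f" "compact K" "\<And>x. x \<notin> K \<Longrightarrow> f x = 0"
  shows "integrable lborel f"
proof -
  have "integrable lborel (\<lambda>x. indicator K x *\<^sub>R f x)"
    using borel_integrable_compact[OF assms(2)] assms(1) continuous_on_subset by blast
  moreover have "(\<lambda>x. indicator K x *\<^sub>R f x) = f" using assms(3) by (intro ext) (auto simp: indicator_def)
  ultimately show ?thesis by simp
qed

lemma Cc_integrable: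
  assumes "f \<in> Cc_infinity" "continuous_on UNIV g"
  shows "integrable lborel (\<lambda>x. f x * g x)"
proof (rule integrable_compact_support)
  show "compact (closure {x. f x \<noteq> 0})" using assms by (simp add: Cc_infinity_def)
  show "f x * g x = 0" if "x \<notin> closure {x. f x \<noteq> 0}" for x
    using that closure_subset[of "{x. f x \<noteq> 0}"] by auto
qed (intro continuous_intros assms Cc_continuous)

lemma integral_partial_eq_0:
  fixes h :: "plane \<Rightarrow> real"
  assumes diff: "h differentiable_on UNIV" and cont: "continuous_on UNIV (partial i h)"
    and K: "compact K" "\<And>x. x \<notin> K \<Longrightarrow> h x = 0" "\<And>x. x \<notin> K \<Longrightarrow> partial i h x = 0"
  shows "(\<integral>x. partial i h x \<partial>lborel) = 0"
proof -
  let ?e = "axis i 1 :: plane"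
  have hc: "continuous_on UNIV h" using diff by (rule differentiable_imp_continuous_on)
  have hi: "integrable lborel h" using hc K by (intro integrable_compact_support) auto
  obtain B where B: "\<And>x. \<bar>partial i h x\<bar> \<le> B" "B \<ge> 0"
  proof -
    have "bounded (partial i h ` K)"
      using K(1) cont by (meson compact_continuous_image compact_imp_bounded continuous_on_subset subset_UNIV)
    then obtain B where "\<And>y. y \<in> partial i h ` K \<Longrightarrow> norm y \<le> B" "B > 0" by (auto simp: bounded_pos)
    then show ?thesis using that[of B] K(3) by (metis abs_zero imageI less_imp_le real_norm_def)
  qed
  obtain R where R: "K \<subseteq> cball 0 R" using bounded_subset_ballD[OF compact_imp_bounded[OF K(1)], of 0] ball_subset_cball by blast
  have line: "((\<lambda>t. h (x + t *\<^sub>R ?e)) has_real_derivative partial i h (x + t *\<^sub>R ?e)) (at t)" for x t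
  proof -
    have "((\<lambda>t. h (x + t *\<^sub>R ?e)) has_derivative
        (\<lambda>s. frechet_derivative h (at (x + t *\<^sub>R ?e)) (s *\<^sub>R ?e))) (at t)"
      by (rule has_derivative_compose[OF _ diff_imp_has_derivative[OF diff]])
         (auto intro!: derivative_eq_intros)
    moreover have "linear (frechet_derivative h (at (x + t *\<^sub>R ?e)))"
      using diff by (simp add: linear_frechet_derivative differentiable_on_def)
    ultimately show ?thesis
      by (simp add: has_field_derivative_def linear_cmul partial_def mult.commute[of _ "frechet_derivative _ _ _"])
  qed
  define q where "q n x = (h (x + inverse (real (Suc n)) *\<^sub>R ?e) - h x) / inverse (real (Suc n))" for n x
  have q0: "(\<integral>x. q n x \<partial>lborel) = 0" for n
  proof -
    let ?v = "inverse (real (Suc n)) *\<^sub>R ?e"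
    have m: "(\<lambda>x. x + ?v) \<in> measurable lborel borel" by measurable
    have hb: "h \<in> borel_measurable borel" using hc by (rule borel_measurable_continuous_onI)
    have d: "lborel = distr lborel borel (\<lambda>x. x + ?v)"
      using lborel_distr_plus[of ?v, symmetric] unfolding add.commute[of ?v] .
    have "integrable lborel (\<lambda>x. h (x + ?v))"
      using hi integrable_distr_eq[OF m hb] unfolding d[symmetric] by blast
    moreover have "(\<integral>x. h (x + ?v) \<partial>lborel) = (\<integral>x. h x \<partial>lborel)"
      using integral_distr[OF m hb] unfolding d[symmetric] by (rule sym)
    ultimately show ?thesis unfolding q_def using hi by simp
  qed
  have "(\<lambda>n. \<integral>x. q n x \<partial>lborel) \<longlonglongrightarrow> (\<integral>x. partial i h x \<partial>lborel)"
  proof (rule integral_dominated_convergence[where w="\<lambda>x. indicator (cball 0 (R+1)) x *\<^sub>R B"])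
    show "partial i h \<in> borel_measurable lborel"
      using borel_measurable_continuous_onI[OF cont] by simp
    have "h \<in> borel_measurable borel" using hc by (rule borel_measurable_continuous_onI)
    then show "q n \<in> borel_measurable lborel" for n unfolding q_def by measurable
    show "integrable lborel (\<lambda>x::plane. indicator (cball 0 (R+1)) x *\<^sub>R B)"
      by (rule borel_integrable_compact) auto
    show "AE x in lborel. (\<lambda>n. q n x) \<longlonglongrightarrow> partial i h x"
    proof (rule AE_I2)
      fix x
      have "((\<lambda>s. (h (x + s *\<^sub>R ?e) - h x) / s) \<longlongrightarrow> partial i h x) (at 0)"
        using line[of x 0] by (simp add: has_field_derivative_iff)
      moreover have "filterlim (\<lambda>n. inverse (real (Suc n))) (at 0) sequentially"
        unfolding filterlim_at using LIMSEQ_inverse_real_of_nat by auto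
      ultimately show "(\<lambda>n. q n x) \<longlonglongrightarrow> partial i h x"
        unfolding q_def by (rule filterlim_compose)
    qed
    show "AE x in lborel. norm (q n x) \<le> indicator (cball 0 (R+1)) x *\<^sub>R B" for n
    proof (rule AE_I2)
      fix x :: plane
      let ?s = "inverse (real (Suc n))"
      have s: "0 < ?s" "?s \<le> 1" by (auto simp: field_simps)
      show "norm (q n x) \<le> indicator (cball 0 (R+1)) x *\<^sub>R B"
      proof (cases "x \<in> cball 0 (R+1)")
        case True
        obtain z where z: "h (x + ?s *\<^sub>R ?e) - h (x + 0 *\<^sub>R ?e) = (?s - 0) * partial i h (x + z *\<^sub>R ?e)"
          using MVT2[OF s(1), of "\<lambda>t. h (x + t *\<^sub>R ?e)" "\<lambda>t. partial i h (x + t *\<^sub>R ?e)"] line by blast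
        have "h (x + ?s *\<^sub>R ?e) - h x = ?s * partial i h (x + z *\<^sub>R ?e)"
          using z by simp
        then have "q n x = partial i h (x + z *\<^sub>R ?e)"
          unfolding q_def using s(1) by (metis less_irrefl nonzero_mult_div_cancel_left)
        then show ?thesis using B True by simp
      next
        case False
        then have n: "norm x > R + 1" by simp
        have "norm x \<le> norm (x + ?s *\<^sub>R ?e) + norm (?s *\<^sub>R ?e)"
          by (metis add_diff_cancel_right' norm_triangle_ineq4)
        moreover have "norm (?s *\<^sub>R ?e) \<le> 1" using s by simp
        ultimately have "norm (x + ?s *\<^sub>R ?e) > R" using n by linarith
        then have "x + ?s *\<^sub>R ?e \<notin> K" "x \<notin> K" using R n by auto
        then show ?thesis using K(2) False by (simp add: q_def)
      qed
    qed
  qed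
  then show ?thesis using q0 by (simp add: LIMSEQ_const_iff)
qed

lemma integral_by_parts:
  assumes f: "f \<in> Cc_infinity" and g: "g \<in> Cc_infinity"
  shows "(\<integral>x. partial i f x * partial i g x \<partial>lborel) = - (\<integral>x. partial i (partial i f) x * g x \<partial>lborel)"
proof -
  let ?p = "partial i f"
  have p: "?p \<in> Cc_infinity" using f by (rule Cc_partial)
  have eq: "partial i (\<lambda>x. ?p x * g x) = (\<lambda>x. partial i ?p x * g x + ?p x * partial i g x)"
    using partial_mult[OF Cc_differentiable[OF p] Cc_differentiable[OF g]] by auto
  have "(\<integral>x. partial i (\<lambda>x. ?p x * g x) x \<partial>lborel) = 0"
  proof (rule integral_partial_eq_0)
    show "(\<lambda>x. ?p x * g x) differentiable_on UNIV"
      by (intro derivative_intros Cc_differentiable p g)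
    show "continuous_on UNIV (partial i (\<lambda>x. ?p x * g x))"
      unfolding eq by (intro continuous_intros Cc_continuous Cc_partial p g)
    show "compact (closure {x. g x \<noteq> 0})" using g by (simp add: Cc_infinity_def)
    show 0: "?p x * g x = 0" if "x \<notin> closure {x. g x \<noteq> 0}" for x
      using that closure_subset[of "{x. g x \<noteq> 0}"] by auto
    show "partial i (\<lambda>x. ?p x * g x) x = 0" if "x \<notin> closure {x. g x \<noteq> 0}" for x
      unfolding eq using that partial_eq_0[OF that] closure_subset[of "{x. g x \<noteq> 0}"] by auto
  qed
  moreover have "integrable lborel (\<lambda>x. partial i ?p x * g x)" "integrable lborel (\<lambda>x. ?p x * partial i g x)"
    by (intro Cc_integrable Cc_partial Cc_continuous p g)+
  ultimately show ?thesis unfolding eq by simp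
qed

definition dirichlet :: "(plane \<Rightarrow> real) \<Rightarrow> (plane \<Rightarrow> real) \<Rightarrow> real" where
  "dirichlet f g = (\<integral>x. (\<Sum>i\<in>UNIV. partial i f x * partial i g x) \<partial>lborel)"

definition w0_prod :: "(plane \<Rightarrow> real) \<Rightarrow> (plane \<Rightarrow> real) \<Rightarrow> real" where
  "w0_prod f g = (\<integral>x. f x * g x * w0 x \<partial>lborel)"

lemma int_dirichlet:
  assumes "f \<in> Cc_infinity" "g \<in> Cc_infinity"
  shows "integrable lborel (\<lambda>x. \<Sum>i\<in>UNIV. partial i f x * partial i g x)"
  by (intro Bochner_Integration.integrable_sum Cc_integrable Cc_partial Cc_continuous assms)

lemma int_w0_prod:
  assumes "f \<in> Cc_infinity" "g \<in> Cc_infinity"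
  shows "integrable lborel (\<lambda>x. f x * g x * w0 x)"
  unfolding mult.assoc by (intro Cc_integrable continuous_intros Cc_continuous assms continuous_w0)

lemma dirichlet_lincomb:
  assumes f: "f \<in> Cc_infinity" and g: "g \<in> Cc_infinity"
  shows "dirichlet (\<lambda>x. f x + c * g x) (\<lambda>x. f x + c * g x)
    = dirichlet f f + 2 * c * dirichlet f g + c\<^sup>2 * dirichlet g g"
proof -
  have "(\<lambda>x. \<Sum>i\<in>UNIV. partial i (\<lambda>x. f x + c * g x) x * partial i (\<lambda>x. f x + c * g x) x) =
    (\<lambda>x. (\<Sum>i\<in>UNIV. partial i f x * partial i f x) + 2 * c * (\<Sum>i\<in>UNIV. partial i f x * partial i g x)
      + c\<^sup>2 * (\<Sum>i\<in>UNIV. partial i g x * partial i g x))"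
    by (rule ext) (simp add: partial_lincomb[OF Cc_differentiable[OF f] Cc_differentiable[OF g]]
        sum_distrib_left sum.distrib[symmetric] algebra_simps power2_eq_square)
  then show ?thesis unfolding dirichlet_def
    using int_dirichlet[OF f f] int_dirichlet[OF f g] int_dirichlet[OF g g] by simp
qed

lemma w0_prod_lincomb:
  assumes f: "f \<in> Cc_infinity" and g: "g \<in> Cc_infinity"
  shows "w0_prod (\<lambda>x. f x + c * g x) (\<lambda>x. f x + c * g x)
    = w0_prod f f + 2 * c * w0_prod f g + c\<^sup>2 * w0_prod g g"
proof -
  have "(\<lambda>x. (f x + c * g x) * (f x + c * g x) * w0 x) =
    (\<lambda>x. f x * f x * w0 x + 2 * c * (f x * g x * w0 x) + c\<^sup>2 * (g x * g x * w0 x))"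
    by (rule ext) (simp add: algebra_simps power2_eq_square)
  then show ?thesis unfolding w0_prod_def
    using int_w0_prod[OF f f] int_w0_prod[OF f g] int_w0_prod[OF g g] by simp
qed

lemma dirichlet_nonneg: "0 \<le> dirichlet f f"
  unfolding dirichlet_def by (rule integral_nonneg_AE) (simp add: sum_nonneg)

lemma w0_prod_nonneg: "0 \<le> w0_prod f f"
proof -
  have "0 \<le> f x * f x * w0 x" for x using w0_ge_1[of x] by simp
  then show ?thesis unfolding w0_prod_def by simp
qed

lemma norm_grad_sq: "(norm (grad f x))\<^sup>2 = (\<Sum>i\<in>UNIV. partial i f x * partial i f x)"
  by (simp add: power2_norm_eq_inner inner_vec_def grad_def)

lemma w0_norm_eq:
  assumes f: "f \<in> Cc_infinity"
  shows "w0_norm f = sqrt (dirichlet f f + w0_prod f f)"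
proof -
  have "(\<integral>x. (norm (grad f x))\<^sup>2 \<partial>lebesgue) = dirichlet f f"
    unfolding norm_grad_sq dirichlet_def
    by (rule integral_completion) (use int_dirichlet[OF f f] in auto)
  moreover have "(\<integral>x. (f x)\<^sup>2 * w0 x \<partial>lebesgue) = w0_prod f f"
    unfolding w0_prod_def power2_eq_square
    by (rule integral_completion) (use int_w0_prod[OF f f] in auto)
  ultimately show ?thesis by (simp add: w0_norm_def)
qed

lemma quadratic_form_CS:
  fixes a b c :: real
  assumes "\<And>t. 0 \<le> a + 2 * t * b + t\<^sup>2 * c" and "0 \<le> a" "0 \<le> c"
  shows "\<bar>b\<bar> \<le> sqrt a * sqrt c"
proof -
  have "b\<^sup>2 \<le> a * c"
  proof (cases "c = 0")
    case True
    have "b = 0"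
    proof (rule ccontr)
      assume "b \<noteq> 0"
      then show False using assms(1)[of "- (a + 1) / (2 * b)"] True by (simp add: field_simps)
    qed
    then show ?thesis using assms by simp
  next
    case False
    have "0 \<le> (a + 2 * (- b / c) * b + (- b / c)\<^sup>2 * c) * c"
      by (intro mult_nonneg_nonneg assms)
    also have "\<dots> = a * c - b\<^sup>2"
    proof -
      have eq: "a + 2 * (- b / c) * b + (- b / c)\<^sup>2 * c = a - b\<^sup>2 / c"
        using False by (simp add: power2_eq_square field_simps)
      show ?thesis unfolding eq using False by (simp add: left_diff_distrib)
    qed
    finally show ?thesis by simp
  qed
  then have "sqrt (b\<^sup>2) \<le> sqrt (a * c)" by (rule real_sqrt_le_mono)
  then show ?thesis by (simp add: real_sqrt_mult)
qed

lemma w0_norm_triangle: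
  assumes f: "f \<in> Cc_infinity" and g: "g \<in> Cc_infinity"
  shows "w0_norm (\<lambda>x. f x + g x) \<le> w0_norm f + w0_norm g"
proof -
  let ?B = "\<lambda>f g. dirichlet f g + w0_prod f g"
  have lc: "?B (\<lambda>x. f x + t * g x) (\<lambda>x. f x + t * g x) = ?B f f + 2 * t * ?B f g + t\<^sup>2 * ?B g g" for t
    using dirichlet_lincomb[OF f g, of t] w0_prod_lincomb[OF f g, of t] by (simp add: algebra_simps)
  have nn: "0 \<le> ?B h h" for h using dirichlet_nonneg w0_prod_nonneg by (simp add: add_nonneg_nonneg)
  have cs: "\<bar>?B f g\<bar> \<le> sqrt (?B f f) * sqrt (?B g g)"
  proof (rule quadratic_form_CS)
    show "0 \<le> ?B f f + 2 * t * ?B f g + t\<^sup>2 * ?B g g" for t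
      using nn[of "\<lambda>x. f x + t * g x"] unfolding lc .
  qed (rule nn)+
  have "?B (\<lambda>x. f x + g x) (\<lambda>x. f x + g x) = ?B f f + 2 * ?B f g + ?B g g"
    using lc[of 1] by simp
  also have "\<dots> \<le> ?B f f + 2 * (sqrt (?B f f) * sqrt (?B g g)) + ?B g g"
    by (intro add_mono mult_left_mono order_refl order_trans[OF abs_ge_self cs]) simp
  also have "\<dots> = (sqrt (?B f f) + sqrt (?B g g))\<^sup>2" using nn by (simp add: power2_sum)
  finally have "sqrt (?B (\<lambda>x. f x + g x) (\<lambda>x. f x + g x)) \<le> sqrt (?B f f) + sqrt (?B g g)"
    using nn by (intro real_le_lsqrt) auto
  moreover have "(\<lambda>x. f x + g x) \<in> Cc_infinity" using Cc_lincomb[OF f g, of 1] by simp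
  ultimately show ?thesis by (simp add: w0_norm_eq f g)
qed

lemma w0_norm_minus: 
  assumes f: "f \<in> Cc_infinity" and g: "g \<in> Cc_infinity"
  shows "w0_norm (\<lambda>x. g x - f x) = w0_norm (\<lambda>x. f x - g x)"
proof -
  have "partial i (\<lambda>x. g x - f x) x = - partial i (\<lambda>x. f x - g x) x" for i x
    using partial_lincomb[OF Cc_differentiable[OF f] Cc_differentiable[OF g], of i "-1" x]
      partial_lincomb[OF Cc_differentiable[OF g] Cc_differentiable[OF f], of i "-1" x] by simp
  then show ?thesis unfolding w0_norm_def norm_grad_sq by (simp add: power2_commute)
qed

lemma w0_norm_diff_le:
  assumes f: "f \<in> Cc_infinity" and g: "g \<in> Cc_infinity"
  shows "\<bar>w0_norm f - w0_norm g\<bar> \<le> w0_norm (\<lambda>x. f x - g x)"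
  using w0_norm_triangle[OF Cc_diff[OF f g] g] w0_norm_triangle[OF Cc_diff[OF g f] f]
    w0_norm_minus[OF f g] by simp

lemma dirichlet_tendsto_0:
  assumes f: "f \<in> Cc_infinity" and \<eta>: "\<And>n. \<eta> n \<in> Cc_infinity"
    and lim: "(\<lambda>n. w0_prod (\<eta> n) (\<eta> n)) \<longlonglongrightarrow> 0"
  shows "(\<lambda>n. dirichlet f (\<eta> n)) \<longlonglongrightarrow> 0"
proof -
  define L where "L x = (\<Sum>i\<in>UNIV. partial i (partial i f) x)" for x
  have ibp: "dirichlet f g = - (\<integral>x. L x * g x \<partial>lborel)" if g: "g \<in> Cc_infinity" for g
    unfolding dirichlet_def L_def sum_distrib_right
    by (subst (1 2) Bochner_Integration.integral_sum)
       (auto intro!: Cc_integrable Cc_partial Cc_continuous f g simp: integral_by_parts[OF f g] sum_negf)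
  have Lc: "continuous_on UNIV L"
    unfolding L_def by (intro continuous_intros Cc_continuous Cc_partial f)
  have Li: "integrable lborel (\<lambda>x. L x * g x)" if "continuous_on UNIV g" for g
    unfolding L_def sum_distrib_right
    by (intro Bochner_Integration.integrable_sum Cc_integrable Cc_partial f that)
  have bound: "\<bar>dirichlet f g\<bar> \<le> sqrt (\<integral>x. L x * L x \<partial>lborel) * sqrt (w0_prod g g)"
    if g: "g \<in> Cc_infinity" for g
  proof -
    have gg: "integrable lborel (\<lambda>x. g x * g x)" by (intro Cc_integrable Cc_continuous g)
    have "\<bar>\<integral>x. L x * g x \<partial>lborel\<bar> \<le> sqrt (\<integral>x. L x * L x \<partial>lborel) * sqrt (\<integral>x. g x * g x \<partial>lborel)"
    proof (rule quadratic_form_CS)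
      fix t
      have "0 \<le> (\<integral>x. (L x + t * g x)\<^sup>2 \<partial>lborel)" by simp
      also have "(\<lambda>x. (L x + t * g x)\<^sup>2) = (\<lambda>x. L x * L x + 2 * t * (L x * g x) + t\<^sup>2 * (g x * g x))"
        by (rule ext) (simp add: power2_eq_square algebra_simps)
      also have "(\<integral>x. L x * L x + 2 * t * (L x * g x) + t\<^sup>2 * (g x * g x) \<partial>lborel) =
        (\<integral>x. L x * L x \<partial>lborel) + 2 * t * (\<integral>x. L x * g x \<partial>lborel) + t\<^sup>2 * (\<integral>x. g x * g x \<partial>lborel)"
        using Li[OF Lc] Li[OF Cc_continuous[OF g]] gg by simp
      finally show "0 \<le> \<dots>" .
    qed simp_all
    also have "(\<integral>x. g x * g x \<partial>lborel) \<le> w0_prod g g"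
      unfolding w0_prod_def using w0_ge_1
      by (intro integral_mono gg int_w0_prod g) (metis mult_left_mono mult.right_neutral zero_le_square)
    finally show ?thesis using ibp[OF g] by (simp add: mult_left_mono)
  qed
  have "(\<lambda>n. sqrt (\<integral>x. L x * L x \<partial>lborel) * sqrt (w0_prod (\<eta> n) (\<eta> n))) \<longlonglongrightarrow> 0"
    using tendsto_mult_right_zero[OF tendsto_real_sqrt[OF lim, simplified]] by simp
  then show ?thesis
    by (rule Lim_null_comparison[rotated]) (use bound \<eta> in auto)
qed

lemma closable:
  assumes C: "w0_Cauchy \<eta>" and lim: "(\<lambda>n. w0_prod (\<eta> n) (\<eta> n)) \<longlonglongrightarrow> 0"
  shows "(\<lambda>n. w0_norm (\<eta> n)) \<longlonglongrightarrow> 0"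
proof -
  have \<eta>: "\<eta> n \<in> Cc_infinity" for n using C by (simp add: w0_Cauchy_def)
  have "(\<lambda>n. dirichlet (\<eta> n) (\<eta> n)) \<longlonglongrightarrow> 0"
  proof (rule LIMSEQ_I)
    fix r :: real assume r: "r > 0"
    then obtain N where N: "\<And>m n. m \<ge> N \<Longrightarrow> n \<ge> N \<Longrightarrow> w0_norm (\<lambda>x. \<eta> m x - \<eta> n x) < sqrt (r / 2)"
      using C unfolding w0_Cauchy_def by (metis half_gt_zero real_sqrt_gt_zero)
    have "dirichlet (\<eta> n) (\<eta> n) \<le> r / 2" if n: "n \<ge> N" for n
    proof (rule LIMSEQ_le_const)
      show "(\<lambda>m. r / 2 + 2 * dirichlet (\<eta> n) (\<eta> m)) \<longlonglongrightarrow> r / 2"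
        using tendsto_add[OF tendsto_const[of "r / 2"]
          tendsto_mult_right_zero[OF dirichlet_tendsto_0[OF \<eta> \<eta> lim], of 2 n]] by simp
      have "dirichlet (\<eta> n) (\<eta> n) \<le> r / 2 + 2 * dirichlet (\<eta> n) (\<eta> m)" if m: "m \<ge> N" for m
      proof -
        let ?d = "\<lambda>x. \<eta> n x - \<eta> m x"
        have "sqrt (dirichlet ?d ?d + w0_prod ?d ?d) < sqrt (r / 2)"
          using N[OF n m] w0_norm_eq[OF Cc_diff[OF \<eta> \<eta>], of n m] by simp
        then have "dirichlet ?d ?d \<le> r / 2" using w0_prod_nonneg[of ?d] by simp
        moreover have "dirichlet ?d ?d = dirichlet (\<eta> n) (\<eta> n) - 2 * dirichlet (\<eta> n) (\<eta> m) + dirichlet (\<eta> m) (\<eta> m)"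
          using dirichlet_lincomb[OF \<eta>[of n] \<eta>[of m], of "-1"] by simp
        ultimately show ?thesis using dirichlet_nonneg[of "\<eta> m"] by linarith
      qed
      then show "\<exists>M. \<forall>m\<ge>M. dirichlet (\<eta> n) (\<eta> n) \<le> r / 2 + 2 * dirichlet (\<eta> n) (\<eta> m)" by blast
    qed
    then show "\<exists>N. \<forall>n\<ge>N. norm (dirichlet (\<eta> n) (\<eta> n) - 0) < r"
      using r dirichlet_nonneg by (intro exI[of _ N]) fastforce
  qed
  from tendsto_real_sqrt[OF tendsto_add[OF this lim]] show ?thesis by (simp add: w0_norm_eq \<eta>)
qed

lemma w0_approx_unique:
  assumes u: "u \<in> borel_measurable lebesgue" and \<phi>: "w0_approx \<phi> u" and \<psi>: "w0_approx \<psi> u"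
  shows "(\<lambda>n. w0_norm (\<lambda>x. \<phi> n x - \<psi> n x)) \<longlonglongrightarrow> 0"
proof (rule closable)
  have c\<phi>: "\<phi> n \<in> Cc_infinity" and c\<psi>: "\<psi> n \<in> Cc_infinity" for n
    using \<phi> \<psi> by (auto simp: w0_approx_def w0_Cauchy_def)
  have c: "(\<lambda>x. \<phi> n x - \<psi> n x) \<in> Cc_infinity" for n by (intro Cc_diff c\<phi> c\<psi>)
  show "w0_Cauchy (\<lambda>n x. \<phi> n x - \<psi> n x)"
    unfolding w0_Cauchy_def
  proof (intro conjI allI impI c)
    fix \<epsilon> :: real assume \<epsilon>: "\<epsilon> > 0"
    obtain N1 where N1: "\<And>m n. m \<ge> N1 \<Longrightarrow> n \<ge> N1 \<Longrightarrow> w0_norm (\<lambda>x. \<phi> m x - \<phi> n x) < \<epsilon> / 2"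
      using \<phi> \<epsilon> unfolding w0_approx_def w0_Cauchy_def by (meson half_gt_zero)
    obtain N2 where N2: "\<And>m n. m \<ge> N2 \<Longrightarrow> n \<ge> N2 \<Longrightarrow> w0_norm (\<lambda>x. \<psi> m x - \<psi> n x) < \<epsilon> / 2"
      using \<psi> \<epsilon> unfolding w0_approx_def w0_Cauchy_def by (meson half_gt_zero)
    have "w0_norm (\<lambda>x. (\<phi> m x - \<psi> m x) - (\<phi> n x - \<psi> n x)) < \<epsilon>" if "m \<ge> max N1 N2" "n \<ge> max N1 N2" for m n
    proof -
      have "w0_norm (\<lambda>x. (\<phi> m x - \<phi> n x) + (\<psi> n x - \<psi> m x)) \<le>
          w0_norm (\<lambda>x. \<phi> m x - \<phi> n x) + w0_norm (\<lambda>x. \<psi> n x - \<psi> m x)"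
        by (intro w0_norm_triangle Cc_diff c\<phi> c\<psi>)
      also have "\<dots> < \<epsilon>" using N1[of m n] N2[of n m] that by simp
      finally show ?thesis by (simp add: algebra_simps)
    qed
    then show "\<exists>N. \<forall>m\<ge>N. \<forall>n\<ge>N. w0_norm (\<lambda>x. \<phi> m x - \<psi> m x - (\<phi> n x - \<psi> n x)) < \<epsilon>" by blast
  qed
  let ?I = "\<lambda>f. \<integral>\<^sup>+x. ennreal ((f x)\<^sup>2 * w0 x) \<partial>lebesgue"
  have w0_pos: "0 \<le> w0 x" for x using w0_ge_1[of x] by simp
  have wm: "w0 \<in> borel_measurable lebesgue"
    using borel_measurable_continuous_onI[OF continuous_w0] by (intro measurable_completion) simp
  have fm: "f \<in> borel_measurable lebesgue" if "f \<in> Cc_infinity" for f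
    using borel_measurable_continuous_onI[OF Cc_continuous[OF that]] by (intro measurable_completion) simp
  have eq: "ennreal (w0_prod f f) = ?I f" if f: "f \<in> Cc_infinity" for f
  proof -
    have "(\<integral>\<^sup>+x. ennreal (f x * f x * w0 x) \<partial>lborel) = ennreal (w0_prod f f)"
      unfolding w0_prod_def by (rule nn_integral_eq_integral[OF int_w0_prod[OF f f]]) (simp add: w0_pos)
    then show ?thesis by (simp add: nn_integral_completion power2_eq_square)
  qed
  have "?I (\<lambda>x. \<phi> n x - \<psi> n x) \<le> 2 * ?I (\<lambda>x. \<phi> n x - u x) + 2 * ?I (\<lambda>x. \<psi> n x - u x)" for n
  proof -
    have "(\<phi> n x - \<psi> n x)\<^sup>2 * w0 x \<le> 2 * ((\<phi> n x - u x)\<^sup>2 * w0 x) + 2 * ((\<psi> n x - u x)\<^sup>2 * w0 x)" for x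
    proof -
      have "(\<phi> n x - \<psi> n x)\<^sup>2 \<le> 2 * (\<phi> n x - u x)\<^sup>2 + 2 * (\<psi> n x - u x)\<^sup>2"
        using zero_le_power2[of "(\<phi> n x - u x) + (\<psi> n x - u x)"]
        by (simp add: power2_eq_square algebra_simps)
      from mult_right_mono[OF this w0_pos[of x]] show ?thesis by (simp add: algebra_simps)
    qed
    then have "?I (\<lambda>x. \<phi> n x - \<psi> n x) \<le> (\<integral>\<^sup>+x. 2 * ennreal ((\<phi> n x - u x)\<^sup>2 * w0 x) + 2 * ennreal ((\<psi> n x - u x)\<^sup>2 * w0 x) \<partial>lebesgue)"
      by (intro nn_integral_mono)
         (simp add: w0_pos ennreal_plus[symmetric] ennreal_mult'[symmetric] ennreal_numeral[symmetric]
           del: ennreal_plus ennreal_numeral)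
    also have "\<dots> = 2 * ?I (\<lambda>x. \<phi> n x - u x) + 2 * ?I (\<lambda>x. \<psi> n x - u x)"
      using u wm fm[OF c\<phi>] fm[OF c\<psi>] by (subst nn_integral_add) (simp_all add: nn_integral_cmult)
    finally show ?thesis .
  qed
  moreover have "(\<lambda>n. 2 * ?I (\<lambda>x. \<phi> n x - u x) + 2 * ?I (\<lambda>x. \<psi> n x - u x)) \<longlonglongrightarrow> 2 * 0 + 2 * 0"
    using \<phi> \<psi> unfolding w0_approx_def by (intro tendsto_add ennreal_tendsto_cmult) auto
  ultimately have "(\<lambda>n. ?I (\<lambda>x. \<phi> n x - \<psi> n x)) \<longlonglongrightarrow> 0"
    by (intro tendsto_sandwich[where f="\<lambda>_. 0" and g="\<lambda>n. ?I (\<lambda>x. \<phi> n x - \<psi> n x)"]) simp_all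
  then have "(\<lambda>n. ennreal (w0_prod (\<lambda>x. \<phi> n x - \<psi> n x) (\<lambda>x. \<phi> n x - \<psi> n x))) \<longlonglongrightarrow> ennreal 0"
    by (simp add: eq[OF c])
  then show "(\<lambda>n. w0_prod (\<lambda>x. \<phi> n x - \<psi> n x) (\<lambda>x. \<phi> n x - \<psi> n x)) \<longlonglongrightarrow> 0"
    by (subst (asm) tendsto_ennreal_iff) (auto simp: w0_prod_nonneg)
qed

theorem H1_w0_norm_tendsto:
  assumes u: "u \<in> borel_measurable lebesgue" and \<phi>: "w0_approx \<phi> u"
  shows "(\<lambda>n. w0_norm (\<phi> n)) \<longlonglongrightarrow> H1_w0_norm u"
proof -
  have "Cauchy (\<lambda>n. w0_norm (\<phi> n))"
  proof (rule CauchyI)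
    fix e :: real assume "e > 0"
    then obtain N where "\<And>m n. m \<ge> N \<Longrightarrow> n \<ge> N \<Longrightarrow> w0_norm (\<lambda>x. \<phi> m x - \<phi> n x) < e"
      using \<phi> unfolding w0_approx_def w0_Cauchy_def by blast
    then show "\<exists>M. \<forall>m\<ge>M. \<forall>n\<ge>M. norm (w0_norm (\<phi> m) - w0_norm (\<phi> n)) < e"
      using \<phi> w0_norm_diff_le unfolding w0_approx_def w0_Cauchy_def real_norm_def
      by (meson le_less_trans)
  qed
  then obtain r where r: "(\<lambda>n. w0_norm (\<phi> n)) \<longlonglongrightarrow> r" using Cauchy_convergent convergent_def by blast
  have "H1_w0_norm u = r" unfolding H1_w0_norm_def
  proof (rule the_equality)
    show "\<exists>\<phi>. w0_approx \<phi> u \<and> (\<lambda>n. w0_norm (\<phi> n)) \<longlonglongrightarrow> r" using \<phi> r by blast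
    fix s assume "\<exists>\<phi>. w0_approx \<phi> u \<and> (\<lambda>n. w0_norm (\<phi> n)) \<longlonglongrightarrow> s"
    then obtain \<psi> where \<psi>: "w0_approx \<psi> u" and s: "(\<lambda>n. w0_norm (\<psi> n)) \<longlonglongrightarrow> s" by blast
    have "(\<lambda>n. w0_norm (\<psi> n) - w0_norm (\<phi> n)) \<longlonglongrightarrow> 0"
    proof (rule Lim_null_comparison[OF _ w0_approx_unique[OF u \<psi> \<phi>]])
      show "\<forall>\<^sub>F n in sequentially. norm (w0_norm (\<psi> n) - w0_norm (\<phi> n)) \<le> w0_norm (\<lambda>x. \<psi> n x - \<phi> n x)"
        using \<phi> \<psi> w0_norm_diff_le by (auto simp: w0_approx_def w0_Cauchy_def)
    qed
    moreover have "(\<lambda>n. w0_norm (\<psi> n) - w0_norm (\<phi> n)) \<longlonglongrightarrow> s - r" using s r by (rule tendsto_diff)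
    ultimately show "s = r" using LIMSEQ_unique by fastforce
  qed
  then show ?thesis using r by simp
qed

lemma Cc_infinity_subset_H1_w0:
  assumes f: "f \<in> Cc_infinity"
  shows "f \<in> H1_w0" and "H1_w0_norm f = w0_norm f"
proof -
  have m: "f \<in> borel_measurable lebesgue"
    using borel_measurable_continuous_onI[OF Cc_continuous[OF f]] by (intro measurable_completion) simp
  have "(\<lambda>x. f x - f x) \<in> Cc_infinity" using f f by (rule Cc_diff)
  then have "w0_norm (\<lambda>x. f x - f x) = 0"
    using w0_norm_eq[of "\<lambda>x. 0"] by (simp add: dirichlet_def w0_prod_def partial_def)
  then have a: "w0_approx (\<lambda>n. f) f" using f by (simp add: w0_approx_def w0_Cauchy_def)
  then show "f \<in> H1_w0" using m by (auto simp: H1_w0_def)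
  show "H1_w0_norm f = w0_norm f" using H1_w0_norm_tendsto[OF m a] by (simp add: LIMSEQ_const_iff)
qed

end

theory Submission
  imports Defs
begin

text \<open>
The critical exponent of the Trudinger--Moser inequality in the plane is $4\pi$, and $2\pi$ lies below it.
This gap leaves room for a proof by potential estimates with explicit constants.

Let $\phi$ be smooth with compact support and of norm about $1$, let $f = |\nabla\phi|$, and localise
around a point $x$ at the radius $R = w_0(x)^{-1/2}$. Averaging $\phi$ along rays gives the potential
estimate \<open>riesz_potential_bound\<close>,
\[ |\phi(x)| \le \frac1\pi\int_{|z|<1}|\phi(x+Rz)|\,dz + \frac{1}{2\pi}\int_{|y|<R}\frac{f(x+y)}{|y|}\,dy. \]
The mean is bounded by the part $\int\phi^2w_0$ of the norm, and this is the reason for the choice of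
$R$. For the potential, a Cauchy--Schwarz inequality with the weight $1 + d|y|^{-3/2}$ yields a
logarithm of the local energy
\[ G(x) = \int_{|y|<R} f(x+y)^2|y|^{-3/2}\,dy \]
(\<open>riesz_potential_log_bound\<close>). The constants are such that
$e^{2\pi\phi(x)^2} \le C(1 + R^{3/2}G(x))$; any exponent below $4\pi$ could be reached in this way, with a
power of $|y|$ closer to $-2$. By Tonelli's theorem
$\int R^{3/2}\,G\,w_0\,dx \le C\int f^2\,dx$, because the powers of the weight cancel
(\<open>nn_integral_riesz_energy_le\<close>). This gives the uniform bound for test functions.

Fatou's lemma extends the bound to the unit ball of the completion. For an arbitrary exponent
$\alpha$, an element of the completion is split into a bounded function of compact support and a
remainder of small norm. The embedding into the Orlicz space follows from the uniform bound by
homogeneity and convexity.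
\<close>

section \<open>Radial integrals in the plane\<close>

text \<open>
Radial primitives such as $\sqrt r$ are not differentiable at the origin. Therefore the
fundamental theorem of calculus is needed with continuity, but no derivative, at the endpoints.
\<close>

lemma nn_integral_FTC_interior:
  fixes f F :: "real \<Rightarrow> real"
  assumes ab: "a \<le> b" and c: "continuous_on {a..b} F"
    and d: "\<And>x. a < x \<Longrightarrow> x < b \<Longrightarrow> (F has_real_derivative f x) (at x)"
    and nn: "\<And>x. a < x \<Longrightarrow> x < b \<Longrightarrow> 0 \<le> f x"
    and [measurable]: "f \<in> borel_measurable borel"
  shows "(\<integral>\<^sup>+x. ennreal (f x) * indicator {a<..<b} x \<partial>lborel) = ennreal (F b - F a)"
proof -
  have "(f has_integral (F b - F a)) {a..b}"
    by (rule fundamental_theorem_of_calculus_interior[OF ab c])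
       (use d in \<open>auto simp: has_real_derivative_iff_has_vector_derivative\<close>)
  then have "(f has_integral (F b - F a)) {a<..<b}"
    using has_integral_open_interval[of f "F b - F a" a b] by (simp add: box_real)
  then have "((\<lambda>x. if x \<in> {a<..<b} then f x else 0) has_integral (F b - F a)) UNIV"
    by (simp only: has_integral_restrict_UNIV)
  from nn_integral_has_integral_lborel[OF _ _ this]
  have "(\<integral>\<^sup>+x. ennreal (if x \<in> {a<..<b} then f x else 0) \<partial>lborel) = ennreal (F b - F a)"
    using nn by simp
  also have "(\<lambda>x. ennreal (if x \<in> {a<..<b} then f x else 0)) = (\<lambda>x. ennreal (f x) * indicator {a<..<b} x)"
    by (auto simp: fun_eq_iff)
  finally show ?thesis .
qed

text \<open>
Polar coordinates, as the image of Lebesgue measure under the norm. Both measures give mass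
$\pi a^2$ to \<open>{..a}\<close> for $a \ge 0$, and these half-lines generate the Borel sets.
\<close>

lemma distr_norm_plane:
  "distr (lborel :: plane measure) borel norm
    = density lborel (\<lambda>r. ennreal (2 * pi * r) * indicator {0<..} r)" (is "?M = ?N")
proof (rule measure_eqI_generator_eq[where E="range atMost" and A="\<lambda>i. {..real i}" and \<Omega>=UNIV])
  show "Int_stable (range atMost :: real set set)"
    by (auto simp: Int_stable_def)
  show "sets ?M = sigma_sets UNIV (range atMost)" "sets ?N = sigma_sets UNIV (range atMost)"
    by (simp_all add: borel_eq_atMost)
  show "(\<Union>i. {..real i}) = UNIV" by (auto intro: real_arch_simple)
  have cb: "emeasure ?M {..a} = (if a < 0 then 0 else ennreal (pi * a\<^sup>2))" for a
  proof -
    have "emeasure ?M {..a} = emeasure lborel (cball (0::plane) a)"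
      by (subst emeasure_distr) (auto intro!: arg_cong[where f="emeasure lborel"])
    then show ?thesis by (auto simp: emeasure_cball unit_ball_vol_2)
  qed
  show "emeasure ?M {..real i} \<noteq> \<infinity>" for i by (simp add: cb)
  show "emeasure ?M X = emeasure ?N X" if X_atMost: "X \<in> range atMost" for X
  proof -
    obtain a where X: "X = {..a}" using X_atMost by blast
    show ?thesis
    proof (cases "a < 0")
      case True
      have "emeasure ?N X = (\<integral>\<^sup>+r. ennreal (2 * pi * r) * indicator {0<..} r * indicator {..a} r \<partial>lborel)"
        unfolding X by (subst emeasure_density) auto
      also have "\<dots> = (\<integral>\<^sup>+(r::real). 0 \<partial>lborel)"
        by (rule nn_integral_cong) (use True in \<open>auto simp: indicator_def\<close>)
      finally have "emeasure ?N X = 0" by simp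
      then show ?thesis using True by (simp add: X cb)
    next
      case False
      have "emeasure ?N X = (\<integral>\<^sup>+r. ennreal (2 * pi * r) * indicator {0<..a} r \<partial>lborel)"
        unfolding X by (subst emeasure_density) (auto intro!: nn_integral_cong simp: indicator_def)
      also have "\<dots> = (\<integral>\<^sup>+r. ennreal (2 * pi * r) * indicator {0<..<a} r \<partial>lborel)"
        by (rule nn_integral_cong_AE, rule eventually_mono[OF AE_lborel_singleton[of a]])
           (auto simp: indicator_def)
      also have "\<dots> = ennreal (pi * a\<^sup>2 - pi * 0\<^sup>2)"
        by (rule nn_integral_FTC_interior)
           (use False in \<open>auto intro!: derivative_eq_intros continuous_intros\<close>)
      finally show ?thesis using False by (simp add: X cb)
    qed
  qed
qed auto

lemma nn_integral_radial:
  assumes [measurable]: "g \<in> borel_measurable borel"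
  shows "(\<integral>\<^sup>+y. g (norm (y::plane)) \<partial>lborel) = (\<integral>\<^sup>+r. ennreal (2 * pi * r) * indicator {0<..} r * g r \<partial>lborel)"
proof -
  have "(\<integral>\<^sup>+y. g (norm (y::plane)) \<partial>lborel) = (\<integral>\<^sup>+r. g r \<partial>distr (lborel :: plane measure) borel norm)"
    by (rule nn_integral_distr[symmetric]) auto
  then show ?thesis unfolding distr_norm_plane by (simp add: nn_integral_density)
qed

lemma nn_integral_radial_disc:
  fixes g F :: "real \<Rightarrow> real"
  assumes "0 \<le> R" and c: "continuous_on {0..R} F"
    and d: "\<And>r. 0 < r \<Longrightarrow> r < R \<Longrightarrow> (F has_real_derivative 2 * pi * r * g r) (at r)"
    and nn: "\<And>r. 0 < r \<Longrightarrow> r < R \<Longrightarrow> 0 \<le> g r"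
    and [measurable]: "g \<in> borel_measurable borel"
  shows "(\<integral>\<^sup>+y. ennreal (g (norm y)) * indicator (ball (0::plane) R) y \<partial>lborel) = ennreal (F R - F 0)"
proof -
  have "(\<integral>\<^sup>+y. ennreal (g (norm y)) * indicator (ball (0::plane) R) y \<partial>lborel)
      = (\<integral>\<^sup>+y. (\<lambda>r. ennreal (g r) * indicator {..<R} r) (norm (y::plane)) \<partial>lborel)"
    by (intro nn_integral_cong) (auto simp: indicator_def)
  also have "\<dots> = (\<integral>\<^sup>+r. ennreal (2 * pi * r) * indicator {0<..} r * (ennreal (g r) * indicator {..<R} r) \<partial>lborel)"
    by (rule nn_integral_radial) measurable
  also have "\<dots> = (\<integral>\<^sup>+r. ennreal (2 * pi * r * g r) * indicator {0<..<R} r \<partial>lborel)"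
    by (intro nn_integral_cong) (auto simp: indicator_def ennreal_mult' nn)
  also have "\<dots> = ennreal (F R - F 0)"
    by (rule nn_integral_FTC_interior) (use assms in auto)
  finally show ?thesis .
qed

text \<open>
The exponent $-3/2$ lies strictly between $-2$ and $-1$: above $-2$ the kernel is integrable at the
origin, and below $-1$ it leaves room in the constant of \<open>exp_le_energy\<close>.
\<close>

lemma nn_integral_disc_three_halves:
  assumes "0 \<le> R"
  shows "(\<integral>\<^sup>+y. ennreal (1 / (norm y * sqrt (norm y))) * indicator (ball (0::plane) R) y \<partial>lborel)
    = ennreal (4 * pi * sqrt R)"
proof -
  have "(\<integral>\<^sup>+y. ennreal (1 / (norm y * sqrt (norm y))) * indicator (ball (0::plane) R) y \<partial>lborel)
      = ennreal (4 * pi * sqrt R - 4 * pi * sqrt 0)"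
  proof (rule nn_integral_radial_disc[where g="\<lambda>r. 1 / (r * sqrt r)" and F="\<lambda>r. 4 * pi * sqrt r"])
    show "((\<lambda>r. 4 * pi * sqrt r) has_real_derivative 2 * pi * r * (1 / (r * sqrt r))) (at r)" if "0 < r" for r
      using that by (auto intro!: derivative_eq_intros simp: field_simps)
  qed (use assms in \<open>auto intro!: continuous_intros\<close>)
  then show ?thesis by simp
qed

text \<open>
The integral of $|y|^{-2}$ diverges logarithmically at the origin. The factor
$1 + d|y|^{-3/2}$ cuts this divergence off at the length $d^{2/3}$, and the integral has the
elementary primitive $\frac{4\pi}{3}\ln(r^{3/2}+d)$.
\<close>

lemma nn_integral_disc_log:
  assumes "0 \<le> R" "0 < d"
  shows "(\<integral>\<^sup>+y. ennreal (1 / ((1 + d / (norm y * sqrt (norm y))) * (norm y)\<^sup>2)) * indicator (ball (0::plane) R) y \<partial>lborel)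
    = ennreal (4 * pi / 3 * ln (1 + R * sqrt R / d))"
proof -
  let ?F = "\<lambda>r. 4 * pi / 3 * ln (r * sqrt r + d)"
  have pos: "r * sqrt r + d > 0" if "0 \<le> r" for r :: real using that assms by (simp add: add_nonneg_pos)
  have "(\<integral>\<^sup>+y. ennreal (1 / ((1 + d / (norm y * sqrt (norm y))) * (norm y)\<^sup>2)) * indicator (ball (0::plane) R) y \<partial>lborel)
      = ennreal (?F R - ?F 0)"
  proof (rule nn_integral_radial_disc[where g="\<lambda>r. 1 / ((1 + d / (r * sqrt r)) * r\<^sup>2)" and F="?F"])
    show "(?F has_real_derivative 2 * pi * r * (1 / ((1 + d / (r * sqrt r)) * r\<^sup>2))) (at r)" if "0 < r" for r
    proof -
      define s where "s = sqrt r"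
      have s: "s > 0" "r = s\<^sup>2" using that by (auto simp: s_def)
      have "(?F has_real_derivative 4 * pi / 3 * ((1 * s + (inverse s / 2) * r) / (r * s + d))) (at r)"
        unfolding s_def using pos[of r] that by (auto intro!: derivative_eq_intros simp: divide_simps)
      moreover have "4 * pi / 3 * ((1 * s + (inverse s / 2) * r) / (r * s + d)) = 2 * pi * r * (1 / ((1 + d / (r * s)) * r\<^sup>2))"
      proof -
        have "r * s + d > 0" using pos[of r] that by (simp add: s_def)
        then have "s^3 + d > 0" by (simp add: s(2) power2_eq_square power3_eq_cube)
        then show ?thesis using s(1) assms(2) unfolding s(2)
          by (simp add: divide_simps power2_eq_square power3_eq_cube)
      qed
      ultimately show ?thesis by (simp add: s_def)
    qed
    show "continuous_on {0..R} ?F"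
      by (intro continuous_intros) (use pos in force)
    show "0 \<le> 1 / ((1 + d / (r * sqrt r)) * r\<^sup>2)" if "0 < r" for r using that assms by simp
  qed (use assms in auto)
  also have "?F R - ?F 0 = 4 * pi / 3 * ln (1 + R * sqrt R / d)"
  proof -
    have "1 + R * sqrt R / d = (R * sqrt R + d) / d" using assms by (simp add: field_simps)
    then show ?thesis using assms pos[of R] by (simp add: ln_div right_diff_distrib)
  qed
  finally show ?thesis .
qed

lemma nn_integral_lborel_scale:
  fixes g :: "plane \<Rightarrow> ennreal"
  assumes [measurable]: "g \<in> borel_measurable borel" and "0 < r"
  shows "(\<integral>\<^sup>+z. g (r *\<^sub>R z) \<partial>lborel) = ennreal (1 / r\<^sup>2) * (\<integral>\<^sup>+y. g y \<partial>lborel)"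
proof -
  have "(\<integral>\<^sup>+y. g y \<partial>lborel) = (\<integral>\<^sup>+y. g y \<partial>density (distr lborel borel (\<lambda>x. 0 + r *\<^sub>R x)) (\<lambda>_. \<bar>r\<bar>^DIM(plane)))"
    using assms by (subst lborel_affine[of r 0]) auto
  also have "\<dots> = ennreal (r\<^sup>2) * (\<integral>\<^sup>+z. g (r *\<^sub>R z) \<partial>lborel)"
    using assms by (simp add: nn_integral_density nn_integral_distr nn_integral_cmult)
  finally have "ennreal (1 / r\<^sup>2) * (\<integral>\<^sup>+y. g y \<partial>lborel) = (ennreal (1 / r\<^sup>2) * ennreal (r\<^sup>2)) * (\<integral>\<^sup>+z. g (r *\<^sub>R z) \<partial>lborel)"
    by (simp add: mult.assoc)
  then show ?thesis using assms by (simp add: ennreal_mult[symmetric])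
qed

lemma nn_integral_lborel_translate:
  fixes g :: "plane \<Rightarrow> ennreal"
  assumes [measurable]: "g \<in> borel_measurable borel"
  shows "(\<integral>\<^sup>+x. g (a + x) \<partial>lborel) = (\<integral>\<^sup>+x. g x \<partial>lborel)"
proof -
  have "(\<integral>\<^sup>+x. g x \<partial>lborel) = (\<integral>\<^sup>+x. g x \<partial>distr lborel borel ((+) a))" by (simp add: lborel_distr_plus)
  then show ?thesis by (simp add: nn_integral_distr)
qed

section \<open>The potential estimate\<close>

lemma ball_in_borel [measurable]: "ball (a::'a::metric_space) r \<in> sets borel"
  by (rule borel_open) simp

lemma continuous_grad:
  assumes "\<phi> \<in> Cc_infinity" shows "continuous_on UNIV (grad \<phi>)"
  unfolding grad_def
  by (intro continuous_on_vec_lambda Cc_continuous Cc_partial assms)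

lemma borel_measurable_Cc [measurable_dest]:
  assumes "\<phi> \<in> Cc_infinity" shows "\<phi> \<in> borel_measurable borel"
  by (rule borel_measurable_continuous_onI[OF Cc_continuous[OF assms]])

lemma borel_measurable_grad:
  assumes "\<phi> \<in> Cc_infinity" shows "grad \<phi> \<in> borel_measurable borel"
  by (rule borel_measurable_continuous_onI[OF continuous_grad[OF assms]])

lemma borel_measurable_w0 [measurable]: "w0 \<in> borel_measurable borel"
  by (rule borel_measurable_continuous_onI[OF continuous_w0])

lemma frechet_derivative_eq_grad:
  assumes "f differentiable_on UNIV"
  shows "frechet_derivative f (at x) h = grad f x \<bullet> h"
proof -
  have lin: "linear (frechet_derivative f (at x))"
    using assms by (simp add: linear_frechet_derivative differentiable_on_def)
  have "frechet_derivative f (at x) h = frechet_derivative f (at x) (\<Sum>i\<in>UNIV. h $ i *\<^sub>R axis i 1)"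
    using basis_expansion[of h] by (simp add: scalar_mult_eq_scaleR)
  also have "\<dots> = (\<Sum>i\<in>UNIV. h $ i * frechet_derivative f (at x) (axis i 1))"
    using lin by (simp add: linear_sum linear_cmul)
  finally show ?thesis by (simp add: grad_def partial_def inner_vec_def mult.commute)
qed

text \<open>
The difference $\phi(x+Rz) - \phi(x)$ is the integral of $\nabla\phi(x+rz)\cdot z$ over $0 \le r \le R$.
\<close>

lemma segment_bound:
  assumes \<phi>: "\<phi> \<in> Cc_infinity" and R: "0 \<le> R"
  shows "ennreal \<bar>\<phi> x\<bar> \<le> ennreal \<bar>\<phi> (x + R *\<^sub>R z)\<bar>
    + (\<integral>\<^sup>+r. ennreal (norm (grad \<phi> (x + r *\<^sub>R z)) * norm z) * indicator {0<..R} r \<partial>lborel)"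
proof -
  define q where "q r = grad \<phi> (x + r *\<^sub>R z) \<bullet> z" for r
  have diff: "\<phi> differentiable_on UNIV" using \<phi> by (rule Cc_differentiable)
  have d: "((\<lambda>r. \<phi> (x + r *\<^sub>R z)) has_real_derivative q r) (at r)" for r
  proof -
    have "((\<lambda>r. \<phi> (x + r *\<^sub>R z)) has_derivative
        (\<lambda>s. frechet_derivative \<phi> (at (x + r *\<^sub>R z)) (s *\<^sub>R z))) (at r)"
      by (rule has_derivative_compose[OF _ diff_imp_has_derivative[OF diff]])
         (auto intro!: derivative_eq_intros)
    then show ?thesis
      unfolding frechet_derivative_eq_grad[OF diff]
      by (simp add: has_field_derivative_def q_def mult_commute_abs)
  qed
  have qc: "continuous_on UNIV q"
    unfolding q_def
    by (intro continuous_intros continuous_on_compose2[OF continuous_grad[OF \<phi>]]) auto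
  then have isc: "isCont q r" for r by (simp add: continuous_on_eq_continuous_at)
  note bi = has_bochner_integral_FTC_Icc_real[OF R d isc]
  have "ennreal \<bar>\<phi> (x + R *\<^sub>R z) - \<phi> x\<bar> \<le> (\<integral>\<^sup>+r. norm (q r * indicator {0..R} r) \<partial>lborel)"
    using has_bochner_integral_norm_bound[OF bi] by simp
  also have "\<dots> \<le> (\<integral>\<^sup>+r. ennreal (norm (grad \<phi> (x + r *\<^sub>R z)) * norm z) * indicator {0<..R} r \<partial>lborel)"
  proof (rule nn_integral_mono_AE, rule eventually_mono[OF AE_lborel_singleton[of 0]])
    show "ennreal (norm (q r * indicator {0..R} r))
        \<le> ennreal (norm (grad \<phi> (x + r *\<^sub>R z)) * norm z) * indicator {0<..R} r" if "r \<noteq> 0" for r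
      using Cauchy_Schwarz_ineq2[of "grad \<phi> (x + r *\<^sub>R z)" z] that
      by (auto simp: q_def indicator_def intro!: ennreal_leI)
  qed
  finally have "ennreal \<bar>\<phi> (x + R *\<^sub>R z)\<bar> + ennreal \<bar>\<phi> (x + R *\<^sub>R z) - \<phi> x\<bar> \<le> ennreal \<bar>\<phi> (x + R *\<^sub>R z)\<bar> + \<dots>"
    by (rule add_left_mono)
  moreover have "ennreal \<bar>\<phi> x\<bar> \<le> ennreal (\<bar>\<phi> (x + R *\<^sub>R z)\<bar> + \<bar>\<phi> (x + R *\<^sub>R z) - \<phi> x\<bar>)"
    by (rule ennreal_leI) simp
  ultimately show ?thesis by (simp add: order.trans)
qed

lemma nn_integral_inverse_cube_le:
  assumes "0 < s"
  shows "(\<integral>\<^sup>+r. ennreal (1 / r^3) * indicator {s<..R} r \<partial>lborel) \<le> ennreal (1 / (2 * s\<^sup>2))"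
proof (cases "s \<le> R")
  case True
  have "(\<integral>\<^sup>+r. ennreal (1 / r^3) * indicator {s<..R} r \<partial>lborel)
      = (\<integral>\<^sup>+r. ennreal (1 / r^3) * indicator {s<..<R} r \<partial>lborel)"
    by (rule nn_integral_cong_AE, rule eventually_mono[OF AE_lborel_singleton[of R]])
       (auto simp: indicator_def)
  also have "\<dots> = ennreal (- 1 / (2 * R\<^sup>2) - (- 1 / (2 * s\<^sup>2)))"
  proof (rule nn_integral_FTC_interior[OF True, where F="\<lambda>r. - 1 / (2 * r\<^sup>2)"])
    show "continuous_on {s..R} (\<lambda>r. - 1 / (2 * r\<^sup>2))"
      using assms by (intro continuous_intros) auto
    show "((\<lambda>r. - 1 / (2 * r\<^sup>2)) has_real_derivative 1 / r^3) (at r)" if "s < r" for r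
      using that assms by (auto intro!: derivative_eq_intros simp: divide_simps power2_eq_square power3_eq_cube)
  qed (use assms in auto)
  also have "\<dots> \<le> ennreal (1 / (2 * s\<^sup>2))" by (rule ennreal_leI) simp
  finally show ?thesis .
next
  case False
  then have "(\<lambda>r. ennreal (1 / r^3) * indicator {s<..R} r) = (\<lambda>r. 0)" by (auto simp: indicator_def)
  then show ?thesis by simp
qed

lemma emeasure_unit_ball_plane: "emeasure lborel (ball (0::plane) 1) = ennreal pi"
  by (simp add: emeasure_ball unit_ball_vol_2)

text \<open>
Average \<open>segment_bound\<close> over $z$ in the unit disc, exchange the integrals, and substitute $y = rz$.
The radius $r$ then integrates to
\[ \int_{|y|}^R r^{-3}\,dr \le \frac{1}{2|y|^2}, \]
which turns the weight $|y|$ into the Riesz kernel $1/(2|y|)$. After division by $\pi$ this is the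
length $1/(2\pi|y|)$ of the gradient of the fundamental solution of the Laplacian, so the leading
constant is sharp.
\<close>

lemma riesz_potential_bound:
  assumes \<phi>: "\<phi> \<in> Cc_infinity" and R: "0 < R"
  shows "ennreal (pi * \<bar>\<phi> x\<bar>) \<le> (\<integral>\<^sup>+z. ennreal \<bar>\<phi> (x + R *\<^sub>R z)\<bar> * indicator (ball 0 1) z \<partial>lborel)
    + (\<integral>\<^sup>+y. ennreal (norm (grad \<phi> (x + y)) / (2 * norm y)) * indicator (ball 0 R) y \<partial>lborel)"
proof -
  define f where "f y = norm (grad \<phi> (x + y))" for y
  note [measurable] = borel_measurable_Cc[OF \<phi>] borel_measurable_grad[OF \<phi>]
  have [measurable]: "f \<in> borel_measurable borel" unfolding f_def by measurable
  have f0: "0 \<le> f y" for y by (simp add: f_def)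
  let ?B = "ball (0::plane) 1"
  define k where "k z r = ennreal (f (r *\<^sub>R z) * norm z) * indicator {0<..R} r * indicator ?B z" for z r
  define K where "K y r = ennreal (f y * norm y) * (ennreal (1 / r^3) * indicator {norm y<..R} r)" for y r
  have [measurable]: "case_prod k \<in> borel_measurable (borel \<Otimes>\<^sub>M borel)"
    unfolding k_def indicator_def mem_ball by measurable
  have [measurable]: "case_prod K \<in> borel_measurable (borel \<Otimes>\<^sub>M borel)"
    unfolding K_def greaterThanAtMost_iff indicator_def by measurable
  have "ennreal (pi * \<bar>\<phi> x\<bar>) = (\<integral>\<^sup>+z. ennreal \<bar>\<phi> x\<bar> * indicator ?B z \<partial>lborel)"
    by (subst nn_integral_cmult)
       (auto intro!: borel_measurable_indicator simp: emeasure_unit_ball_plane ennreal_mult mult.commute)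
  also have "\<dots> \<le> (\<integral>\<^sup>+z. ennreal \<bar>\<phi> (x + R *\<^sub>R z)\<bar> * indicator ?B z + (\<integral>\<^sup>+r. k z r \<partial>lborel) \<partial>lborel)"
  proof (rule nn_integral_mono)
    fix z
    show "ennreal \<bar>\<phi> x\<bar> * indicator ?B z \<le> ennreal \<bar>\<phi> (x + R *\<^sub>R z)\<bar> * indicator ?B z + (\<integral>\<^sup>+r. k z r \<partial>lborel)"
      using segment_bound[OF \<phi>, of R x z] R by (auto simp: k_def f_def indicator_def)
  qed
  also have "\<dots> = (\<integral>\<^sup>+z. ennreal \<bar>\<phi> (x + R *\<^sub>R z)\<bar> * indicator ?B z \<partial>lborel) + (\<integral>\<^sup>+z. \<integral>\<^sup>+r. k z r \<partial>lborel \<partial>lborel)"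
    by (rule nn_integral_add) measurable
  also have "(\<integral>\<^sup>+z. \<integral>\<^sup>+r. k z r \<partial>lborel \<partial>lborel) = (\<integral>\<^sup>+r. \<integral>\<^sup>+z. k z r \<partial>lborel \<partial>lborel)"
    by (rule lborel_pair.Fubini'[symmetric]) measurable
  also have "\<dots> = (\<integral>\<^sup>+r. \<integral>\<^sup>+y. K y r \<partial>lborel \<partial>lborel)"
  proof (rule nn_integral_cong)
    fix r
    show "(\<integral>\<^sup>+z. k z r \<partial>lborel) = (\<integral>\<^sup>+y. K y r \<partial>lborel)"
    proof (cases "r \<in> {0<..R}")
      case False
      then have "k z r = 0" "K z r = 0" for z
        using le_less_trans[OF norm_ge_zero[of z], of r] by (auto simp: k_def K_def indicator_def)
      then show ?thesis by simp
    next
      case True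
      let ?g = "\<lambda>y. ennreal (f y * (norm y / r)) * indicator (ball 0 r) y"
      have "k z r = ?g (r *\<^sub>R z)" for z
        using True by (auto simp: k_def indicator_def)
      then have "(\<integral>\<^sup>+z. k z r \<partial>lborel) = ennreal (1 / r\<^sup>2) * (\<integral>\<^sup>+y. ?g y \<partial>lborel)"
        using nn_integral_lborel_scale[of ?g r] True by simp
      also have "\<dots> = (\<integral>\<^sup>+y. ennreal (1 / r\<^sup>2) * ?g y \<partial>lborel)"
        by (rule nn_integral_cmult[symmetric]) measurable
      also have "(\<lambda>y. ennreal (1 / r\<^sup>2) * ?g y) = (\<lambda>y. K y r)"
        using True f0
        by (auto simp: K_def indicator_def ennreal_mult[symmetric] power2_eq_square power3_eq_cube fun_eq_iff)
      finally show ?thesis .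
    qed
  qed
  also have "\<dots> = (\<integral>\<^sup>+y. \<integral>\<^sup>+r. K y r \<partial>lborel \<partial>lborel)"
    by (rule lborel_pair.Fubini') measurable
  also have "\<dots> \<le> (\<integral>\<^sup>+y. ennreal (f y / (2 * norm y)) * indicator (ball 0 R) y \<partial>lborel)"
  proof (rule nn_integral_mono)
    fix y :: plane
    have eq: "(\<integral>\<^sup>+r. K y r \<partial>lborel) = ennreal (f y * norm y) * (\<integral>\<^sup>+r. ennreal (1 / r^3) * indicator {norm y<..R} r \<partial>lborel)"
      unfolding K_def by (rule nn_integral_cmult) measurable
    show "(\<integral>\<^sup>+r. K y r \<partial>lborel) \<le> ennreal (f y / (2 * norm y)) * indicator (ball 0 R) y"
    proof (cases "y \<noteq> 0 \<and> norm y < R")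
      case True
      have "(\<integral>\<^sup>+r. K y r \<partial>lborel) \<le> ennreal (f y * norm y) * ennreal (1 / (2 * (norm y)\<^sup>2))"
        unfolding eq using True by (intro mult_left_mono nn_integral_inverse_cube_le) auto
      also have "\<dots> = ennreal (f y / (2 * norm y))"
        using True f0 by (simp add: ennreal_mult[symmetric] power2_eq_square)
      finally show ?thesis using True by simp
    next
      case False
      then have "(\<lambda>r. K y r) = (\<lambda>r. 0)" by (auto simp: K_def indicator_def)
      then show ?thesis by simp
    qed
  qed
  finally show ?thesis unfolding f_def by (simp add: add_left_mono)
qed

text \<open>
On discs of radius at most $1$ the weight is constant up to a factor $2$. This is what permits the
radius of localisation to depend on the weight at the centre.
\<close>

lemma w0_slowly_varying:
  assumes "norm y \<le> 1"
  shows "w0 (x + y) \<le> 2 * w0 x"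
proof -
  have "exp 1 + norm (x + y) \<le> 2 * (exp 1 + norm x)"
    unfolding distrib_left
    using norm_triangle_ineq[of x y] assms exp_ge_add_one_self[of "1::real"] norm_ge_zero[of x] by linarith
  then have "w0 (x + y) \<le> ln (2 * (exp 1 + norm x))"
    unfolding w0_def by (subst ln_le_cancel_iff) (auto intro: add_pos_nonneg)
  also have "\<dots> = ln 2 + w0 x"
    unfolding w0_def by (rule ln_mult_pos) (auto intro: add_pos_nonneg)
  also have "\<dots> \<le> 2 * w0 x"
    using w0_ge_1[of x] ln_2_less_1 by linarith
  finally show ?thesis .
qed

section \<open>The exponential integral of a test function\<close>

text \<open>
The radius at which the two terms of \<open>riesz_potential_bound\<close> balance: the mean of $\phi^2$ over a
disc of radius $R \le 1$ at $x$ is at most a multiple of $R^{-2} w_0(x)^{-1}\int\phi^2w_0$, which is bounded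
independently of $x$ for $R = w_0(x)^{-1/2}$.
\<close>

definition local_radius :: "plane \<Rightarrow> real" where
  "local_radius x = 1 / sqrt (w0 x)"

text \<open>
A localised Riesz potential of $|\nabla\phi|^2$. It serves as a substitute for the maximal function
of $|\nabla\phi|$: it controls the part of the potential near the singularity, and it can be
integrated by Tonelli's theorem alone.
\<close>

definition riesz_energy :: "(plane \<Rightarrow> real) \<Rightarrow> plane \<Rightarrow> ennreal" where
  "riesz_energy \<phi> x =
    (\<integral>\<^sup>+y. ennreal ((norm (grad \<phi> (x + y)))\<^sup>2 * (1 / (norm y * sqrt (norm y)))) * indicator (ball 0 (local_radius x)) y \<partial>lborel)"

lemma local_radius_pos: "0 < local_radius x"
  using w0_ge_1[of x] by (simp add: local_radius_def)

lemma local_radius_le_1: "local_radius x \<le> 1"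
  using w0_ge_1[of x] by (simp add: local_radius_def)

lemma w0_eq_local_radius: "w0 x = 1 / (local_radius x)\<^sup>2"
  using w0_ge_1[of x] by (simp add: local_radius_def power_divide)

lemma nn_integral_w0_prod:
  assumes \<phi>: "\<phi> \<in> Cc_infinity"
  shows "(\<integral>\<^sup>+x. ennreal (\<phi> x * \<phi> x * w0 x) \<partial>lborel) = ennreal (w0_prod \<phi> \<phi>)"
proof -
  have "0 \<le> \<phi> x * \<phi> x * w0 x" for x 
    using mult_nonneg_nonneg[OF zero_le_square, of "w0 x"] w0_ge_1[of x] by simp
  then show ?thesis
    unfolding w0_prod_def by (intro nn_integral_eq_integral int_w0_prod \<phi>) simp
qed

text \<open>
Estimate $|t| \le 1 + t^2$, rescale the disc to radius \<open>local_radius x\<close>, and move the resulting factor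
\<open>w0 x\<close> inside the integral.
\<close>

lemma nn_integral_mean_le:
  assumes \<phi>: "\<phi> \<in> Cc_infinity" and P: "w0_prod \<phi> \<phi> \<le> 11/10"
  shows "(\<integral>\<^sup>+z. ennreal \<bar>\<phi> (x + local_radius x *\<^sub>R z)\<bar> * indicator (ball 0 1) z \<partial>lborel) \<le> ennreal (2 * pi)"
proof -
  note [measurable] = borel_measurable_Cc[OF \<phi>]
  let ?R = "local_radius x" and ?B = "ball (0::plane) 1"
  let ?g = "\<lambda>y. ennreal ((\<phi> (x + y))\<^sup>2) * indicator (ball 0 ?R) y"
  have "(\<integral>\<^sup>+z. ennreal \<bar>\<phi> (x + ?R *\<^sub>R z)\<bar> * indicator ?B z \<partial>lborel) \<le> (\<integral>\<^sup>+z. indicator ?B z + ?g (?R *\<^sub>R z) \<partial>lborel)"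
  proof (rule nn_integral_mono)
    fix z
    have "\<bar>t\<bar> \<le> 1 + t\<^sup>2" for t :: real
      using zero_le_power2[of "\<bar>t\<bar> - 1"] by (simp add: power2_eq_square algebra_simps abs_mult_self_eq)
    then have "ennreal \<bar>\<phi> (x + ?R *\<^sub>R z)\<bar> \<le> 1 + ennreal ((\<phi> (x + ?R *\<^sub>R z))\<^sup>2)"
      by (subst ennreal_1[symmetric], subst ennreal_plus[symmetric]) (auto intro: ennreal_leI simp del: ennreal_plus)
    then show "ennreal \<bar>\<phi> (x + ?R *\<^sub>R z)\<bar> * indicator ?B z \<le> indicator ?B z + ?g (?R *\<^sub>R z)"
      using local_radius_pos[of x] by (auto simp: indicator_def)
  qed
  also have "\<dots> = ennreal pi + (\<integral>\<^sup>+z. ?g (?R *\<^sub>R z) \<partial>lborel)"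
    by (subst nn_integral_add) (auto simp: emeasure_unit_ball_plane)
  also have "(\<integral>\<^sup>+z. ?g (?R *\<^sub>R z) \<partial>lborel) = ennreal (w0 x) * (\<integral>\<^sup>+y. ?g y \<partial>lborel)"
    unfolding w0_eq_local_radius by (rule nn_integral_lborel_scale) (use local_radius_pos in auto)
  also have "\<dots> = (\<integral>\<^sup>+y. ennreal (w0 x) * ?g y \<partial>lborel)"
    by (rule nn_integral_cmult[symmetric]) measurable
  also have "\<dots> \<le> (\<integral>\<^sup>+y. 2 * ennreal (\<phi> (x + y) * \<phi> (x + y) * w0 (x + y)) \<partial>lborel)"
  proof (rule nn_integral_mono)
    fix y
    show "ennreal (w0 x) * ?g y \<le> 2 * ennreal (\<phi> (x + y) * \<phi> (x + y) * w0 (x + y))"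
    proof (cases "norm y < ?R")
      case True
      then have "w0 x \<le> 2 * w0 (x + y)"
        using w0_slowly_varying[of "- y" "x + y"] local_radius_le_1[of x] by simp
      from mult_right_mono[OF this zero_le_power2[of "\<phi> (x + y)"]]
      have "ennreal (w0 x * (\<phi> (x + y))\<^sup>2) \<le> ennreal (2 * (\<phi> (x + y) * \<phi> (x + y) * w0 (x + y)))"
        by (intro ennreal_leI) (simp add: power2_eq_square mult.commute mult.left_commute)
      moreover have "0 \<le> w0 x" "0 \<le> w0 (x + y)" using w0_ge_1[of x] w0_ge_1[of "x + y"] by auto
      ultimately show ?thesis using True by (simp add: ennreal_mult)
    qed simp
  qed
  also have "\<dots> = 2 * (\<integral>\<^sup>+y. ennreal (\<phi> y * \<phi> y * w0 y) \<partial>lborel)"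
    by (subst nn_integral_cmult) (auto intro!: arg_cong[where f="(*) 2"] nn_integral_lborel_translate)
  also have "(\<integral>\<^sup>+y. ennreal (\<phi> y * \<phi> y * w0 y) \<partial>lborel) = ennreal (w0_prod \<phi> \<phi>)"
    by (rule nn_integral_w0_prod[OF \<phi>])
  also have "ennreal pi + 2 * ennreal (w0_prod \<phi> \<phi>) = ennreal (pi + 2 * w0_prod \<phi> \<phi>)"
    using w0_prod_nonneg[of \<phi>] by (simp add: ennreal_mult)
  also have "\<dots> \<le> ennreal (2 * pi)"
    using P pi_gt3 by (intro ennreal_leI) simp
  finally show ?thesis by (simp add: add_left_mono)
qed

lemma nn_integral_grad_sq:
  assumes \<phi>: "\<phi> \<in> Cc_infinity"
  shows "(\<integral>\<^sup>+x. ennreal ((norm (grad \<phi> x))\<^sup>2) \<partial>lborel) = ennreal (dirichlet \<phi> \<phi>)"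
  unfolding norm_grad_sq dirichlet_def
  by (rule nn_integral_eq_integral[OF int_dirichlet[OF \<phi> \<phi>]]) (simp add: sum_nonneg)

text \<open>
A weighted Cauchy--Schwarz inequality with $h(y) = 1 + d|y|^{-3/2}$:
\[ \Bigl(\int_{|y|<R} \frac{f(x+y)}{2|y|}\,dy\Bigr)^2
   \le \frac14 \int_{|y|<R} f(x+y)^2 h(y)\,dy \int_{|y|<R} \frac{dy}{h(y)|y|^2}. \]
The first factor is the Dirichlet integral plus $d$ times the local energy $G$, the second is
\<open>nn_integral_disc_log\<close>. With $d$ of the order of $R^{3/2}/(1+R^{3/2}G)$ the first factor is at most
$6/5$, whereas the second is logarithmic in $G$.
\<close>

lemma riesz_potential_log_bound:
  assumes \<phi>: "\<phi> \<in> Cc_infinity" and D: "dirichlet \<phi> \<phi> \<le> 11/10"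
    and G: "riesz_energy \<phi> x = ennreal G" "0 \<le> G" and g: "g = local_radius x * sqrt (local_radius x) * G"
  shows "(\<integral>\<^sup>+y. ennreal (norm (grad \<phi> (x + y)) / (2 * norm y)) * indicator (ball 0 (local_radius x)) y \<partial>lborel)
    \<le> ennreal (3/5 * sqrt (10 * pi / 9 * ln (1 + 10 * (1 + g))))"
proof -
  note [measurable] = borel_measurable_grad[OF \<phi>]
  define R where "R = local_radius x"
  define f where "f y = norm (grad \<phi> (x + y))" for y
  have [measurable]: "f \<in> borel_measurable borel" unfolding f_def by measurable
  have f0: "0 \<le> f y" for y by (simp add: f_def)
  have R: "0 < R" "0 \<le> R" using local_radius_pos[of x] by (simp_all add: R_def)
  have g0: "0 \<le> g" using G R by (simp add: g R_def)
  \<comment> \<open>chosen such that $dG \le 1/10$; the summand $1$ keeps $d$ finite when $G = 0$\<close>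
  define d where "d = R * sqrt R / (10 * (1 + g))"
  have d: "0 < d" using R g0 by (simp add: d_def)
  define h where "h y = 1 + d / (norm y * sqrt (norm y))" for y :: plane
  have h: "1 \<le> h y" for y using d by (simp add: h_def)
  have [measurable]: "h \<in> borel_measurable borel" unfolding h_def by measurable
  define L where "L = ln (1 + 10 * (1 + g))"
  have L: "0 < L" using g0 by (simp add: L_def)
  \<comment> \<open>the parameter for which $2ab \le la^2 + b^2/l$ becomes the Cauchy--Schwarz inequality\<close>
  define l where "l = sqrt (10 * pi / 9 * L)"
  have l: "0 < l" using L by (simp add: l_def)
  let ?B = "ball (0::plane) R"
  have X: "(\<integral>\<^sup>+y. ennreal ((f y)\<^sup>2 * h y) * indicator ?B y \<partial>lborel) \<le> ennreal (6/5)"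
  proof -
    have "(\<integral>\<^sup>+y. ennreal ((f y)\<^sup>2 * h y) * indicator ?B y \<partial>lborel) \<le>
      (\<integral>\<^sup>+y. ennreal ((f y)\<^sup>2) + ennreal d * (ennreal ((f y)\<^sup>2 * (1 / (norm y * sqrt (norm y)))) * indicator ?B y) \<partial>lborel)"
    proof (rule nn_integral_mono)
      fix y
      have "ennreal ((f y)\<^sup>2 * h y) = ennreal ((f y)\<^sup>2) + ennreal d * ennreal ((f y)\<^sup>2 * (1 / (norm y * sqrt (norm y))))"
        using d by (simp add: h_def ennreal_mult[symmetric] ennreal_plus[symmetric] distrib_left mult.commute del: ennreal_plus)
      then show "ennreal ((f y)\<^sup>2 * h y) * indicator ?B y \<le> ennreal ((f y)\<^sup>2) + ennreal d * (ennreal ((f y)\<^sup>2 * (1 / (norm y * sqrt (norm y)))) * indicator ?B y)"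
        by (simp add: indicator_def)
    qed
    also have "\<dots> = (\<integral>\<^sup>+y. ennreal ((f y)\<^sup>2) \<partial>lborel) + ennreal d * riesz_energy \<phi> x"
      unfolding riesz_energy_def f_def[symmetric] R_def[symmetric]
      by (subst nn_integral_add) (auto simp: nn_integral_cmult)
    also have "(\<integral>\<^sup>+y. ennreal ((f y)\<^sup>2) \<partial>lborel) = ennreal (dirichlet \<phi> \<phi>)"
      unfolding f_def nn_integral_grad_sq[OF \<phi>, symmetric] by (rule nn_integral_lborel_translate) measurable
    also have "ennreal (dirichlet \<phi> \<phi>) + ennreal d * riesz_energy \<phi> x = ennreal (dirichlet \<phi> \<phi> + d * G)"
      using d G dirichlet_nonneg[of \<phi>] by (simp add: ennreal_mult)
    also have "\<dots> \<le> ennreal (6/5)"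
    proof (rule ennreal_leI)
      have "d * G = g / (10 * (1 + g))" by (simp add: d_def g R_def)
      also have "\<dots> \<le> 1/10" using g0 by (simp add: field_simps)
      finally show "dirichlet \<phi> \<phi> + d * G \<le> 6/5" using D by simp
    qed
    finally show ?thesis .
  qed
  have Y: "(\<integral>\<^sup>+y. ennreal (1 / (h y * (norm y)\<^sup>2)) * indicator ?B y \<partial>lborel) = ennreal (4 * pi / 3 * L)"
  proof -
    have "R * sqrt R / d = 10 * (1 + g)" using R g0 by (simp add: d_def)
    then show ?thesis unfolding h_def L_def using nn_integral_disc_log[OF R(2) d] by simp
  qed
  have "(\<integral>\<^sup>+y. ennreal (f y / (2 * norm y)) * indicator ?B y \<partial>lborel) \<le>
     (\<integral>\<^sup>+y. ennreal (l / 4) * (ennreal ((f y)\<^sup>2 * h y) * indicator ?B y)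
        + ennreal (1 / (4 * l)) * (ennreal (1 / (h y * (norm y)\<^sup>2)) * indicator ?B y) \<partial>lborel)"
  proof (rule nn_integral_mono)
    fix y
    have "f y / (2 * norm y) \<le> l / 4 * ((f y)\<^sup>2 * h y) + 1 / (4 * l) * (1 / (h y * (norm y)\<^sup>2))"
    proof (cases "y = 0")
      case False
      have hp: "0 < h y" using h[of y] by simp
      have "0 \<le> (l * h y * f y * norm y - 1)\<^sup>2 / (4 * l * h y * (norm y)\<^sup>2)" using l hp by simp
      also have "\<dots> = l / 4 * ((f y)\<^sup>2 * h y) + 1 / (4 * l) * (1 / (h y * (norm y)\<^sup>2)) - f y / (2 * norm y)"
        using l hp False by (simp add: divide_simps) (simp add: power2_eq_square algebra_simps)
      finally show ?thesis by simp
    qed (use l h[of y] in auto)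
    then have "ennreal (f y / (2 * norm y)) \<le> ennreal (l / 4) * ennreal ((f y)\<^sup>2 * h y) + ennreal (1 / (4 * l)) * ennreal (1 / (h y * (norm y)\<^sup>2))"
      using l h[of y] by (simp add: ennreal_mult[symmetric] ennreal_plus[symmetric] ennreal_leI del: ennreal_plus)
    then show "ennreal (f y / (2 * norm y)) * indicator ?B y \<le> ennreal (l / 4) * (ennreal ((f y)\<^sup>2 * h y) * indicator ?B y)
        + ennreal (1 / (4 * l)) * (ennreal (1 / (h y * (norm y)\<^sup>2)) * indicator ?B y)"
      by (simp add: indicator_def)
  qed
  also have "\<dots> = ennreal (l / 4) * (\<integral>\<^sup>+y. ennreal ((f y)\<^sup>2 * h y) * indicator ?B y \<partial>lborel)
      + ennreal (1 / (4 * l)) * (\<integral>\<^sup>+y. ennreal (1 / (h y * (norm y)\<^sup>2)) * indicator ?B y \<partial>lborel)"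
    by (subst nn_integral_add) (auto simp: nn_integral_cmult)
  also have "\<dots> \<le> ennreal (l / 4) * ennreal (6/5) + ennreal (1 / (4 * l)) * ennreal (4 * pi / 3 * L)"
    unfolding Y by (intro add_mono mult_left_mono X) auto
  also have "\<dots> = ennreal (l / 4 * (6/5) + 1 / (4 * l) * (4 * pi / 3 * L))"
    using l L by (simp only: ennreal_mult[symmetric] ennreal_plus[symmetric])
      (simp add: ennreal_mult[symmetric] ennreal_plus[symmetric] del: ennreal_plus)
  also have "l / 4 * (6/5) + 1 / (4 * l) * (4 * pi / 3 * L) = 3/5 * l"
  proof -
    have "4 * pi / 3 * L = 6/5 * l\<^sup>2" using L by (simp add: l_def)
    then show ?thesis using l by (simp only:) (simp add: field_simps power2_eq_square)
  qed
  finally show ?thesis by (simp add: f_def R_def l_def L_def)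
qed

text \<open>
The factor $11$ dominates $2\pi$, and both coefficients of $11 + 10g$ in \<open>exp_le_energy\<close>.
\<close>

definition TM_const :: real where
  "TM_const = 11 * exp (40 * pi)"

text \<open>
By the preceding bounds $|\phi(x)| \le 2 + s$ with $2\pi s^2 = \frac45 \ln(1+10(1+g))$. Absorbing the bounded
summand $2$ costs a factor $\frac54$, and $\frac54 \cdot \frac45 = 1$. The exponential is therefore at most
linear in $g$.
\<close>

lemma exp_le_energy:
  assumes \<phi>: "\<phi> \<in> Cc_infinity" and D: "dirichlet \<phi> \<phi> \<le> 11/10" and P: "w0_prod \<phi> \<phi> \<le> 11/10"
    and G: "riesz_energy \<phi> x = ennreal G" "0 \<le> G" and g: "g = local_radius x * sqrt (local_radius x) * G"
  shows "exp (2 * pi * (\<phi> x)\<^sup>2) \<le> exp (40 * pi) * (11 + 10 * g)"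
proof -
  have g0: "0 \<le> g" using G local_radius_pos[of x] by (simp add: g)
  define L where "L = ln (1 + 10 * (1 + g))"
  have L: "0 < L" using g0 by (simp add: L_def)
  define s where "s = 3/5 * sqrt (10 * pi / 9 * L) / pi"
  have s: "0 \<le> s" using L by (simp add: s_def)
  have "ennreal (pi * \<bar>\<phi> x\<bar>) \<le> ennreal (2 * pi) + ennreal (3/5 * sqrt (10 * pi / 9 * L))"
    using riesz_potential_bound[OF \<phi> local_radius_pos]
      add_mono[OF nn_integral_mean_le[OF \<phi> P] riesz_potential_log_bound[OF \<phi> D G g]]
    unfolding L_def by (rule order.trans)
  also have "\<dots> = ennreal (2 * pi + pi * s)"
    using L by (simp add: s_def)
  finally have "pi * \<bar>\<phi> x\<bar> \<le> pi * (2 + s)"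
    using s by (subst (asm) ennreal_le_iff) (auto simp: algebra_simps)
  then have "\<bar>\<phi> x\<bar> \<le> 2 + s" by simp
  then have "\<bar>\<phi> x\<bar>\<^sup>2 \<le> (2 + s)\<^sup>2" by (intro power_mono) auto
  also have "\<dots> \<le> 5/4 * s\<^sup>2 + 20"
    using zero_le_power2[of "s / 2 - 4"] by (simp add: power2_eq_square algebra_simps)
  finally have "2 * pi * (\<phi> x)\<^sup>2 \<le> 2 * pi * (5/4 * s\<^sup>2 + 20)" by (intro mult_left_mono) auto
  also have "\<dots> = L + 40 * pi"
  proof -
    have "s\<^sup>2 = 9/25 * (10 * pi / 9 * L) / pi\<^sup>2" using L by (simp add: s_def power_divide power_mult_distrib)
    then show ?thesis by (simp add: power2_eq_square field_simps)
  qed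
  finally have "exp (2 * pi * (\<phi> x)\<^sup>2) \<le> exp (L + 40 * pi)" by simp
  also have "\<dots> = exp (40 * pi) * (11 + 10 * g)" using g0 by (simp add: exp_add L_def)
  finally show ?thesis .
qed

lemma exp_minus_1_le:
  fixes t :: real shows "exp t - 1 \<le> t * exp t"
proof -
  have "1 + (- t) \<le> exp (- t)" by (rule exp_ge_add_one_self)
  from mult_right_mono[OF this, of "exp t"] show ?thesis
    by (simp add: algebra_simps exp_minus)
qed

text \<open>
The bound \<open>exp_le_energy\<close> contains a constant, which has infinite integral. Where
$\phi^2 > 1$ the constant is dominated by $\phi^2$. Elsewhere \<open>exp_minus_1_le\<close> alone gives a multiple of
$\phi^2$.
\<close>

lemma exp_minus_1_le_energy:
  assumes \<phi>: "\<phi> \<in> Cc_infinity" and D: "dirichlet \<phi> \<phi> \<le> 11/10" and P: "w0_prod \<phi> \<phi> \<le> 11/10"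
  shows "ennreal (exp (2 * pi * (\<phi> x)\<^sup>2) - 1)
    \<le> ennreal (TM_const * (\<phi> x)\<^sup>2) + ennreal TM_const * (ennreal (local_radius x * sqrt (local_radius x)) * riesz_energy \<phi> x)"
proof (cases "riesz_energy \<phi> x" rule: ennreal_cases)
  case (real G)
  define g where "g = local_radius x * sqrt (local_radius x) * G"
  have g0: "0 \<le> g" using real local_radius_pos[of x] by (simp add: g_def)
  have "exp (2 * pi * (\<phi> x)\<^sup>2) - 1 \<le> TM_const * (\<phi> x)\<^sup>2 + TM_const * g"
  proof (cases "(\<phi> x)\<^sup>2 \<le> 1")
    case True
    let ?t = "2 * pi * (\<phi> x)\<^sup>2"
    have "exp ?t - 1 \<le> ?t * exp ?t" by (rule exp_minus_1_le)
    also have "\<dots> \<le> ?t * exp (40 * pi)"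
    proof (rule mult_left_mono)
      have "?t \<le> 2 * pi * 1" using True by (intro mult_left_mono) auto
      then show "exp ?t \<le> exp (40 * pi)" using pi_gt_zero by simp
    qed simp
    also have "\<dots> \<le> TM_const * (\<phi> x)\<^sup>2"
      using mult_right_mono[of "2 * pi" 11 "(\<phi> x)\<^sup>2 * exp (40 * pi)"] pi_less_4
      by (simp add: TM_const_def mult.commute mult.left_commute)
    finally show ?thesis using g0 by (simp add: TM_const_def add_increasing2)
  next
    case False
    have "exp (2 * pi * (\<phi> x)\<^sup>2) - 1 \<le> exp (40 * pi) * (11 + 10 * g)"
      using exp_le_energy[OF \<phi> D P real(2) real(1) g_def] by simp
    also have "\<dots> \<le> exp (40 * pi) * (11 * (\<phi> x)\<^sup>2 + 11 * g)"
      using False g0 by (intro mult_left_mono) auto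
    finally show ?thesis by (simp add: TM_const_def algebra_simps)
  qed
  then have "ennreal (exp (2 * pi * (\<phi> x)\<^sup>2) - 1) \<le> ennreal (TM_const * (\<phi> x)\<^sup>2 + TM_const * g)"
    by (rule ennreal_leI)
  also have "\<dots> = ennreal (TM_const * (\<phi> x)\<^sup>2) + ennreal TM_const * (ennreal (local_radius x * sqrt (local_radius x)) * riesz_energy \<phi> x)"
    using real g0 local_radius_pos[of x] by (simp add: g_def TM_const_def ennreal_mult)
  finally show ?thesis .
next
  case top
  then show ?thesis using local_radius_pos[of x]
    by (simp add: TM_const_def ennreal_mult_top)
qed

lemma borel_measurable_local_radius [measurable]: "local_radius \<in> borel_measurable borel"
  unfolding local_radius_def by measurable

text \<open>
Only the Dirichlet integral without weight appears on the right, although the left side carries the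
weight \<open>w0\<close>. With $R$ = \<open>local_radius x\<close> one has $R^{3/2}w_0(x) = R^{-1/2}$. After Tonelli's theorem and a
translation, each $|\nabla\phi(x)|^2$ is multiplied by at most
\[ \sqrt{2/R} \int_{|y|<2R} |y|^{-3/2}\,dy = \sqrt{2/R}\cdot 4\pi\sqrt{2R} = 8\pi, \]
and the powers of $R$ cancel.
\<close>

lemma nn_integral_riesz_energy_le:
  assumes \<phi>: "\<phi> \<in> Cc_infinity"
  shows "(\<integral>\<^sup>+x. ennreal (local_radius x * sqrt (local_radius x)) * riesz_energy \<phi> x * ennreal (w0 x) \<partial>lborel)
    \<le> ennreal (8 * pi) * ennreal (dirichlet \<phi> \<phi>)"
proof -
  note [measurable] = borel_measurable_grad[OF \<phi>]
  define F where "F x = (norm (grad \<phi> x))\<^sup>2" for x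
  define \<kappa> where "\<kappa> y = 1 / (norm y * sqrt (norm y))" for y :: plane
  have [measurable]: "F \<in> borel_measurable borel" "\<kappa> \<in> borel_measurable borel"
    unfolding F_def \<kappa>_def by measurable
  have nn: "0 \<le> F x" "0 \<le> \<kappa> x" for x by (simp_all add: F_def \<kappa>_def)
  define q where "q x y = ennreal (F (x + y) * \<kappa> y / sqrt (local_radius x)) * indicator (ball 0 (local_radius x)) y" for x y
  have [measurable]: "case_prod q \<in> borel_measurable (borel \<Otimes>\<^sub>M borel)"
    unfolding q_def indicator_def mem_ball by measurable
  have "(\<integral>\<^sup>+x. ennreal (local_radius x * sqrt (local_radius x)) * riesz_energy \<phi> x * ennreal (w0 x) \<partial>lborel)
      = (\<integral>\<^sup>+x. \<integral>\<^sup>+y. q x y \<partial>lborel \<partial>lborel)"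
  proof (rule nn_integral_cong)
    fix x
    have w: "local_radius x * sqrt (local_radius x) * w0 x = 1 / sqrt (local_radius x)"
    proof -
      define t where "t = sqrt (local_radius x)"
      have "0 < t" "local_radius x = t\<^sup>2" using local_radius_pos[of x] by (simp_all add: t_def)
      then show ?thesis unfolding w0_eq_local_radius by (simp add: power2_eq_square)
    qed
    have "ennreal (local_radius x * sqrt (local_radius x)) * riesz_energy \<phi> x * ennreal (w0 x)
        = ennreal (local_radius x * sqrt (local_radius x) * w0 x) * riesz_energy \<phi> x"
      using w0_ge_1[of x] local_radius_pos[of x] by (subst ennreal_mult) (simp_all only: ac_simps, auto)
    also have "\<dots> = (\<integral>\<^sup>+y. ennreal (1 / sqrt (local_radius x)) * (ennreal (F (x + y) * \<kappa> y) * indicator (ball 0 (local_radius x)) y) \<partial>lborel)"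
      unfolding w riesz_energy_def F_def \<kappa>_def by (rule nn_integral_cmult[symmetric]) measurable
    also have "\<dots> = (\<integral>\<^sup>+y. q x y \<partial>lborel)"
    proof (rule nn_integral_cong)
      fix y
      have "ennreal (F (x + y) * \<kappa> y / sqrt (local_radius x)) = ennreal (1 / sqrt (local_radius x)) * ennreal (F (x + y) * \<kappa> y)"
        using local_radius_pos[of x] nn by (subst ennreal_mult[symmetric]) auto
      then show "ennreal (1 / sqrt (local_radius x)) * (ennreal (F (x + y) * \<kappa> y) * indicator (ball 0 (local_radius x)) y) = q x y"
        by (simp only: q_def mult.assoc)
    qed
    finally show "ennreal (local_radius x * sqrt (local_radius x)) * riesz_energy \<phi> x * ennreal (w0 x) = (\<integral>\<^sup>+y. q x y \<partial>lborel)" .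
  qed
  also have "\<dots> = (\<integral>\<^sup>+y. \<integral>\<^sup>+x. q x y \<partial>lborel \<partial>lborel)"
    by (rule lborel_pair.Fubini'[symmetric]) measurable
  also have "\<dots> = (\<integral>\<^sup>+y. \<integral>\<^sup>+x. q (- y + x) y \<partial>lborel \<partial>lborel)"
  proof (rule nn_integral_cong)
    fix y
    have "(\<lambda>x. q x y) \<in> borel_measurable borel" by measurable
    from nn_integral_lborel_translate[OF this, of "- y"]
    show "(\<integral>\<^sup>+x. q x y \<partial>lborel) = (\<integral>\<^sup>+x. q (- y + x) y \<partial>lborel)" by simp
  qed
  also have "\<dots> = (\<integral>\<^sup>+x. \<integral>\<^sup>+y. q (- y + x) y \<partial>lborel \<partial>lborel)"
    by (rule lborel_pair.Fubini') measurable
  also have "\<dots> \<le> (\<integral>\<^sup>+x. ennreal (8 * pi) * ennreal (F x) \<partial>lborel)"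
  proof (rule nn_integral_mono)
    fix x
    let ?S = "2 * local_radius x"
    have S: "0 < ?S" using local_radius_pos[of x] by simp
    have "(\<integral>\<^sup>+y. q (- y + x) y \<partial>lborel) \<le> (\<integral>\<^sup>+y. ennreal (F x * sqrt (2 / local_radius x)) * (ennreal (\<kappa> y) * indicator (ball 0 ?S) y) \<partial>lborel)"
    proof (rule nn_integral_mono)
      fix y
      show "q (- y + x) y \<le> ennreal (F x * sqrt (2 / local_radius x)) * (ennreal (\<kappa> y) * indicator (ball 0 ?S) y)"
      proof (cases "norm y < local_radius (- y + x)")
        case True
        then have y: "norm y \<le> 1" using local_radius_le_1[of "- y + x"] by simp
        \<comment> \<open>a weight changing by a factor $2$ changes the radius by at most $\sqrt 2 \le 2$\<close>
        have comp: "local_radius a \<le> 2 * local_radius b" if "w0 b \<le> 2 * w0 a" for a b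
        proof -
          have p: "0 < w0 a" "0 < w0 b" using w0_ge_1[of a] w0_ge_1[of b] by simp_all
          have "sqrt (w0 b) \<le> sqrt (4 * w0 a)" using that p by (intro real_sqrt_le_mono) simp
          then have "sqrt (w0 b) \<le> 2 * sqrt (w0 a)" by (simp add: real_sqrt_mult)
          then show ?thesis using p by (simp add: local_radius_def divide_simps)
        qed
        have 1: "local_radius (- y + x) \<le> ?S" using w0_slowly_varying[of y "- y + x"] y by (intro comp) simp
        have 2: "local_radius x \<le> 2 * local_radius (- y + x)" using w0_slowly_varying[of "- y" x] y by (intro comp) (simp add: add.commute)
        have "1 / sqrt (local_radius (- y + x)) \<le> sqrt (2 / local_radius x)"
        proof -
          have "1 / local_radius (- y + x) \<le> 2 / local_radius x"
            using 2 local_radius_pos[of x] local_radius_pos[of "- y + x"] by (simp add: divide_simps)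
          from real_sqrt_le_mono[OF this] show ?thesis by (simp add: real_sqrt_divide)
        qed
        then have "ennreal (F x * \<kappa> y * (1 / sqrt (local_radius (- y + x)))) \<le> ennreal (F x * \<kappa> y * sqrt (2 / local_radius x))"
          using nn by (intro ennreal_leI mult_left_mono) auto
        also have "F x * \<kappa> y * sqrt (2 / local_radius x) = F x * sqrt (2 / local_radius x) * \<kappa> y" by simp
        also have "ennreal (F x * sqrt (2 / local_radius x) * \<kappa> y) = ennreal (F x * sqrt (2 / local_radius x)) * ennreal (\<kappa> y)"
          by (rule ennreal_mult) (use nn local_radius_pos[of x] in auto)
        finally show ?thesis using True 1 by (simp add: q_def)
      qed (simp add: q_def)
    qed
    also have "\<dots> = ennreal (F x * sqrt (2 / local_radius x)) * ennreal (4 * pi * sqrt ?S)"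
      unfolding \<kappa>_def using S by (subst nn_integral_cmult) (auto simp: nn_integral_disc_three_halves)
    also have "\<dots> = ennreal (8 * pi) * ennreal (F x)"
    proof -
      have "sqrt (2 / local_radius x) * sqrt ?S = 2"
        using local_radius_pos[of x] by (simp add: real_sqrt_mult[symmetric])
      moreover have "F x * sqrt (2 / local_radius x) * (4 * pi * sqrt ?S) = F x * (4 * pi) * (sqrt (2 / local_radius x) * sqrt ?S)"
        by (simp only: ac_simps)
      ultimately have "F x * sqrt (2 / local_radius x) * (4 * pi * sqrt ?S) = 8 * pi * F x" by simp
      moreover have "ennreal (F x * sqrt (2 / local_radius x)) * ennreal (4 * pi * sqrt ?S) = ennreal (F x * sqrt (2 / local_radius x) * (4 * pi * sqrt ?S))"
        by (rule ennreal_mult[symmetric]) (use nn S in auto)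
      moreover have "ennreal (8 * pi * F x) = ennreal (8 * pi) * ennreal (F x)"
        by (rule ennreal_mult) (use nn in auto)
      ultimately show ?thesis by (simp only:)
    qed
    finally show "(\<integral>\<^sup>+y. q (- y + x) y \<partial>lborel) \<le> ennreal (8 * pi) * ennreal (F x)" .
  qed
  also have "\<dots> = ennreal (8 * pi) * ennreal (dirichlet \<phi> \<phi>)"
    using nn_integral_grad_sq[OF \<phi>] by (simp add: nn_integral_cmult F_def)
  finally show ?thesis .
qed

text \<open>
The number $40$ exceeds $\frac{11}{10}(1 + 8\pi)$, which collects the contributions of the two parts of the norm.
\<close>

definition TM_bound :: real where "TM_bound = TM_const * 40"

lemma TM_bound_ge_1: "1 \<le> TM_bound"
proof -
  have "1 \<le> exp (40 * pi)" by simp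
  then show ?thesis unfolding TM_bound_def TM_const_def by linarith
qed

text \<open>
The bound $11/10$ on the squared norm, in place of $1$, is possible because $2\pi$ is below the
critical exponent. It is used in \<open>trudinger_moser_H1\<close>, where the approximants of an element of the
unit ball need not lie in the unit ball.
\<close>

lemma trudinger_moser_Cc:
  assumes \<phi>: "\<phi> \<in> Cc_infinity" and N: "(w0_norm \<phi>)\<^sup>2 \<le> 11/10"
  shows "(\<integral>\<^sup>+x. ennreal ((exp (2 * pi * (\<phi> x)\<^sup>2) - 1) * w0 x) \<partial>lborel) \<le> ennreal TM_bound"
proof -
  note [measurable] = borel_measurable_Cc[OF \<phi>] borel_measurable_grad[OF \<phi>]
  have "dirichlet \<phi> \<phi> + w0_prod \<phi> \<phi> \<le> 11/10"
    using N dirichlet_nonneg[of \<phi>] w0_prod_nonneg[of \<phi>] by (simp add: w0_norm_eq[OF \<phi>])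
  then have D: "dirichlet \<phi> \<phi> \<le> 11/10" and P: "w0_prod \<phi> \<phi> \<le> 11/10"
    using dirichlet_nonneg[of \<phi>] w0_prod_nonneg[of \<phi>] by simp_all
  have K: "0 \<le> TM_const" by (simp add: TM_const_def)
  have w: "0 \<le> w0 x" for x using w0_ge_1[of x] by simp
  have [measurable]: "riesz_energy \<phi> \<in> borel_measurable borel"
    unfolding riesz_energy_def[abs_def] indicator_def mem_ball by measurable
  have "(\<integral>\<^sup>+x. ennreal ((exp (2 * pi * (\<phi> x)\<^sup>2) - 1) * w0 x) \<partial>lborel)
    \<le> (\<integral>\<^sup>+x. ennreal TM_const * ennreal (\<phi> x * \<phi> x * w0 x)
        + ennreal TM_const * (ennreal (local_radius x * sqrt (local_radius x)) * riesz_energy \<phi> x * ennreal (w0 x)) \<partial>lborel)"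
  proof (rule nn_integral_mono)
    fix x
    have "ennreal ((exp (2 * pi * (\<phi> x)\<^sup>2) - 1) * w0 x) = ennreal (exp (2 * pi * (\<phi> x)\<^sup>2) - 1) * ennreal (w0 x)"
      using w by (simp add: ennreal_mult)
    also have "\<dots> \<le> (ennreal (TM_const * (\<phi> x)\<^sup>2) + ennreal TM_const * (ennreal (local_radius x * sqrt (local_radius x)) * riesz_energy \<phi> x)) * ennreal (w0 x)"
      by (rule mult_right_mono[OF exp_minus_1_le_energy[OF \<phi> D P]]) simp
    also have "\<dots> = ennreal TM_const * ennreal (\<phi> x * \<phi> x * w0 x)
        + ennreal TM_const * (ennreal (local_radius x * sqrt (local_radius x)) * riesz_energy \<phi> x * ennreal (w0 x))"
    proof -
      have "ennreal (TM_const * (\<phi> x)\<^sup>2) * ennreal (w0 x) = ennreal TM_const * ennreal (\<phi> x * \<phi> x * w0 x)"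
      proof -
        have "0 \<le> \<phi> x * \<phi> x * w0 x" using mult_nonneg_nonneg[OF zero_le_square w] .
        then show ?thesis
          using K w by (subst (1 2) ennreal_mult[symmetric]) (auto simp: power2_eq_square mult.assoc)
      qed
      then show ?thesis by (simp only: distrib_right mult.assoc)
    qed
    finally show "ennreal ((exp (2 * pi * (\<phi> x)\<^sup>2) - 1) * w0 x) \<le> \<dots>" .
  qed
  also have "\<dots> = ennreal TM_const * (\<integral>\<^sup>+x. ennreal (\<phi> x * \<phi> x * w0 x) \<partial>lborel)
      + ennreal TM_const * (\<integral>\<^sup>+x. ennreal (local_radius x * sqrt (local_radius x)) * riesz_energy \<phi> x * ennreal (w0 x) \<partial>lborel)"
    by (subst nn_integral_add) (auto simp: nn_integral_cmult)
  also have "(\<integral>\<^sup>+x. ennreal (\<phi> x * \<phi> x * w0 x) \<partial>lborel) = ennreal (w0_prod \<phi> \<phi>)"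
    by (rule nn_integral_w0_prod[OF \<phi>])
  also have "ennreal TM_const * ennreal (w0_prod \<phi> \<phi>)
      + ennreal TM_const * (\<integral>\<^sup>+x. ennreal (local_radius x * sqrt (local_radius x)) * riesz_energy \<phi> x * ennreal (w0 x) \<partial>lborel)
    \<le> ennreal TM_const * ennreal (w0_prod \<phi> \<phi>) + ennreal TM_const * (ennreal (8 * pi) * ennreal (dirichlet \<phi> \<phi>))"
    by (intro add_left_mono mult_left_mono nn_integral_riesz_energy_le \<phi>) simp
  also have "\<dots> = ennreal (TM_const * (w0_prod \<phi> \<phi> + 8 * pi * dirichlet \<phi> \<phi>))"
    using K w0_prod_nonneg[of \<phi>] dirichlet_nonneg[of \<phi>]
    by (simp add: ennreal_mult[symmetric] ennreal_plus[symmetric] distrib_left del: ennreal_plus)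
  also have "\<dots> \<le> ennreal TM_bound"
    unfolding TM_bound_def
  proof (intro ennreal_leI mult_left_mono K)
    have "8 * pi * dirichlet \<phi> \<phi> \<le> 32 * (11/10)"
      using D dirichlet_nonneg[of \<phi>] pi_less_4 by (intro mult_mono) auto
    then show "w0_prod \<phi> \<phi> + 8 * pi * dirichlet \<phi> \<phi> \<le> 40" using P by simp
  qed
  finally show ?thesis .
qed

section \<open>Passage to the completion\<close>

lemma zero_in_Cc: "(\<lambda>x. 0) \<in> Cc_infinity"
  if "\<phi> \<in> Cc_infinity"
  using Cc_diff[OF that that] by simp

lemma Cc_cmult:
  assumes \<phi>: "\<phi> \<in> Cc_infinity"
  shows "(\<lambda>x. c * \<phi> x) \<in> Cc_infinity"
  using Cc_lincomb[OF zero_in_Cc[OF \<phi>] \<phi>, of c] by simp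

lemma w0_norm_cmult:
  assumes \<phi>: "\<phi> \<in> Cc_infinity"
  shows "w0_norm (\<lambda>x. c * \<phi> x) = \<bar>c\<bar> * w0_norm \<phi>"
proof -
  have "dirichlet (\<lambda>x. c * \<phi> x) (\<lambda>x. c * \<phi> x) = c\<^sup>2 * dirichlet \<phi> \<phi>"
    using dirichlet_lincomb[OF zero_in_Cc[OF \<phi>] \<phi>, of c] by (simp add: dirichlet_def partial_def)
  moreover have "w0_prod (\<lambda>x. c * \<phi> x) (\<lambda>x. c * \<phi> x) = c\<^sup>2 * w0_prod \<phi> \<phi>"
    using w0_prod_lincomb[OF zero_in_Cc[OF \<phi>] \<phi>, of c] by (simp add: w0_prod_def)
  ultimately show ?thesis
    by (simp add: w0_norm_eq \<phi> Cc_cmult distrib_left[symmetric] real_sqrt_mult)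
qed

lemma w0_approx_affine:
  assumes u: "u \<in> borel_measurable lebesgue" and \<phi>: "w0_approx \<phi> u" and \<psi>: "\<psi> \<in> Cc_infinity"
  shows "w0_approx (\<lambda>n x. c * (\<phi> n x - \<psi> x)) (\<lambda>x. c * (u x - \<psi> x))"
proof -
  have c\<phi>: "\<phi> n \<in> Cc_infinity" for n using \<phi> by (simp add: w0_approx_def w0_Cauchy_def)
  have [measurable]: "f \<in> borel_measurable lebesgue" if "f \<in> Cc_infinity" for f
    using borel_measurable_Cc[OF that] by (intro measurable_completion) simp
  have [measurable]: "w0 \<in> borel_measurable lebesgue" by (intro measurable_completion) simp
  note [measurable] = u
  have "w0_Cauchy (\<lambda>n x. c * (\<phi> n x - \<psi> x))"
    unfolding w0_Cauchy_def
  proof (intro conjI allI impI)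
    show "(\<lambda>x. c * (\<phi> n x - \<psi> x)) \<in> Cc_infinity" for n
      by (intro Cc_cmult Cc_diff c\<phi> \<psi>)
    fix \<epsilon> :: real assume \<epsilon>: "\<epsilon> > 0"
    then have "0 < \<epsilon> / (\<bar>c\<bar> + 1)" by simp
    then obtain N where N: "\<And>m n. m \<ge> N \<Longrightarrow> n \<ge> N \<Longrightarrow> w0_norm (\<lambda>x. \<phi> m x - \<phi> n x) < \<epsilon> / (\<bar>c\<bar> + 1)"
      using \<phi> unfolding w0_approx_def w0_Cauchy_def by blast
    have "w0_norm (\<lambda>x. c * (\<phi> m x - \<psi> x) - c * (\<phi> n x - \<psi> x)) < \<epsilon>" if "m \<ge> N" "n \<ge> N" for m n
    proof -
      have "(\<lambda>x. c * (\<phi> m x - \<psi> x) - c * (\<phi> n x - \<psi> x)) = (\<lambda>x. c * (\<phi> m x - \<phi> n x))"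
        by (auto simp: algebra_simps)
      then have "w0_norm (\<lambda>x. c * (\<phi> m x - \<psi> x) - c * (\<phi> n x - \<psi> x)) = \<bar>c\<bar> * w0_norm (\<lambda>x. \<phi> m x - \<phi> n x)"
        by (simp add: w0_norm_cmult Cc_diff c\<phi>)
      also have "\<dots> \<le> \<bar>c\<bar> * (\<epsilon> / (\<bar>c\<bar> + 1))"
        using N[OF that] by (intro mult_left_mono) auto
      also have "\<dots> < \<epsilon>" using \<epsilon> by (simp add: field_simps)
      finally show ?thesis .
    qed
    then show "\<exists>N. \<forall>m\<ge>N. \<forall>n\<ge>N. w0_norm (\<lambda>x. c * (\<phi> m x - \<psi> x) - c * (\<phi> n x - \<psi> x)) < \<epsilon>" by blast
  qed
  moreover have "(\<integral>\<^sup>+x. ennreal ((c * (\<phi> n x - \<psi> x) - c * (u x - \<psi> x))\<^sup>2 * w0 x) \<partial>lebesgue)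
      = ennreal (c\<^sup>2) * (\<integral>\<^sup>+x. ennreal ((\<phi> n x - u x)\<^sup>2 * w0 x) \<partial>lebesgue)" for n
  proof -
    have "(c * (\<phi> n x - \<psi> x) - c * (u x - \<psi> x))\<^sup>2 * w0 x = c\<^sup>2 * ((\<phi> n x - u x)\<^sup>2 * w0 x)" for x
    proof -
      have "c * (\<phi> n x - \<psi> x) - c * (u x - \<psi> x) = c * (\<phi> n x - u x)" by (simp add: algebra_simps)
      then show ?thesis by (simp add: power_mult_distrib)
    qed
    then have "(\<integral>\<^sup>+x. ennreal ((c * (\<phi> n x - \<psi> x) - c * (u x - \<psi> x))\<^sup>2 * w0 x) \<partial>lebesgue)
        = (\<integral>\<^sup>+x. ennreal (c\<^sup>2) * ennreal ((\<phi> n x - u x)\<^sup>2 * w0 x) \<partial>lebesgue)"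
      by (simp only: ennreal_mult'[OF zero_le_power2])
    then show ?thesis using c\<phi> by (simp add: nn_integral_cmult)
  qed
  moreover have "(\<lambda>n. ennreal (c\<^sup>2) * (\<integral>\<^sup>+x. ennreal ((\<phi> n x - u x)\<^sup>2 * w0 x) \<partial>lebesgue)) \<longlonglongrightarrow> ennreal (c\<^sup>2) * 0"
    using \<phi> unfolding w0_approx_def by (intro ennreal_tendsto_cmult) auto
  ultimately show ?thesis by (simp add: w0_approx_def)
qed

text \<open>
With $\psi$ a late approximant of $u$, the second part says that the remainder $u - \psi$ has small
norm in the completion.
\<close>

lemma H1_w0_affine:
  assumes u: "u \<in> borel_measurable lebesgue" and \<phi>: "w0_approx \<phi> u" and \<psi>: "\<psi> \<in> Cc_infinity"
  shows "(\<lambda>x. c * (u x - \<psi> x)) \<in> H1_w0"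
    and "(\<lambda>n. \<bar>c\<bar> * w0_norm (\<lambda>x. \<phi> n x - \<psi> x)) \<longlonglongrightarrow> H1_w0_norm (\<lambda>x. c * (u x - \<psi> x))"
proof -
  have c\<phi>: "\<phi> n \<in> Cc_infinity" for n using \<phi> by (simp add: w0_approx_def w0_Cauchy_def)
  have [measurable]: "\<psi> \<in> borel_measurable lebesgue"
    using borel_measurable_Cc[OF \<psi>] by (intro measurable_completion) simp
  have m: "(\<lambda>x. c * (u x - \<psi> x)) \<in> borel_measurable lebesgue" using u by measurable
  note a = w0_approx_affine[OF u \<phi> \<psi>, of c]
  show "(\<lambda>x. c * (u x - \<psi> x)) \<in> H1_w0" using m a by (auto simp: H1_w0_def)
  show "(\<lambda>n. \<bar>c\<bar> * w0_norm (\<lambda>x. \<phi> n x - \<psi> x)) \<longlonglongrightarrow> H1_w0_norm (\<lambda>x. c * (u x - \<psi> x))"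
    using H1_w0_norm_tendsto[OF m a] by (simp add: w0_norm_cmult Cc_diff c\<phi> \<psi>)
qed

lemma H1_w0_cmult:
  assumes u: "u \<in> H1_w0"
  shows "(\<lambda>x. c * u x) \<in> H1_w0" and "H1_w0_norm (\<lambda>x. c * u x) = \<bar>c\<bar> * H1_w0_norm u"
proof -
  from u obtain \<phi> where m: "u \<in> borel_measurable lebesgue" and \<phi>: "w0_approx \<phi> u"
    by (auto simp: H1_w0_def)
  have z: "(\<lambda>x. 0) \<in> Cc_infinity"
    using \<phi> zero_in_Cc[of "\<phi> 0"] by (simp add: w0_approx_def w0_Cauchy_def)
  show "(\<lambda>x. c * u x) \<in> H1_w0" using H1_w0_affine(1)[OF m \<phi> z, of c] by simp
  have "(\<lambda>n. \<bar>c\<bar> * w0_norm (\<phi> n)) \<longlonglongrightarrow> H1_w0_norm (\<lambda>x. c * u x)"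
    using H1_w0_affine(2)[OF m \<phi> z, of c] by simp
  moreover have "(\<lambda>n. \<bar>c\<bar> * w0_norm (\<phi> n)) \<longlonglongrightarrow> \<bar>c\<bar> * H1_w0_norm u"
    by (intro tendsto_mult_left H1_w0_norm_tendsto m \<phi>)
  ultimately show "H1_w0_norm (\<lambda>x. c * u x) = \<bar>c\<bar> * H1_w0_norm u" by (rule LIMSEQ_unique)
qed

lemma H1_w0_norm_nonneg:
  assumes u: "u \<in> H1_w0"
  shows "0 \<le> H1_w0_norm u"
proof -
  from u obtain \<phi> where m: "u \<in> borel_measurable lebesgue" and \<phi>: "w0_approx \<phi> u"
    by (auto simp: H1_w0_def)
  have "0 \<le> w0_norm (\<phi> n)" for n
    using \<phi> dirichlet_nonneg[of "\<phi> n"] w0_prod_nonneg[of "\<phi> n"]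
    by (simp add: w0_norm_eq w0_approx_def w0_Cauchy_def)
  then show ?thesis by (intro LIMSEQ_le_const[OF H1_w0_norm_tendsto[OF m \<phi>]]) auto
qed

text \<open>
As $w_0 \ge 1$, convergence in $L^2(w_0\,dx)$ implies convergence almost everywhere along a subsequence.
\<close>

lemma w0_approx_AE_subseq:
  assumes u: "u \<in> borel_measurable lebesgue" and \<phi>: "w0_approx \<phi> u"
  shows "\<exists>\<rho>::nat \<Rightarrow> nat. strict_mono \<rho> \<and> (AE x in lebesgue. (\<lambda>n. \<phi> (\<rho> n) x) \<longlonglongrightarrow> u x)"
proof -
  have c\<phi>: "\<phi> n \<in> Cc_infinity" for n using \<phi> by (simp add: w0_approx_def w0_Cauchy_def)
  have [measurable]: "\<phi> n \<in> borel_measurable lebesgue" for n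
    using borel_measurable_Cc[OF c\<phi>] by (intro measurable_completion) simp
  have [measurable]: "w0 \<in> borel_measurable lebesgue" by (intro measurable_completion) simp
  note [measurable] = u
  have w: "0 \<le> w0 x" for x using w0_ge_1[of x] by simp
  define I where "I n = (\<integral>\<^sup>+x. ennreal ((\<phi> n x - u x)\<^sup>2 * w0 x) \<partial>lebesgue)" for n
  have I: "I \<longlonglongrightarrow> 0" using \<phi> unfolding w0_approx_def I_def by simp
  \<comment> \<open>the convergence yields finite integrals, and thus integrability, for a tail of the sequence\<close>
  then have "\<forall>\<^sub>F n in sequentially. I n < 1" by (rule order_tendstoD) simp
  then obtain N where N: "\<And>n. n \<ge> N \<Longrightarrow> I n < 1" by (auto simp: eventually_sequentially)
  define g where "g n x = (\<phi> (n + N) x - u x)\<^sup>2 * w0 x" for n x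
  have g0: "0 \<le> g n x" for n x using w by (simp add: g_def)
  have [measurable]: "g n \<in> borel_measurable lebesgue" for n unfolding g_def by measurable
  have gI: "(\<integral>\<^sup>+x. ennreal (g n x) \<partial>lebesgue) = I (n + N)" for n by (simp add: g_def I_def)
  have int: "integrable lebesgue (g n)" for n
    by (rule integrableI_nonneg) (use N[of "n + N"] g0 in \<open>auto simp: gI intro: order.strict_trans\<close>)
  have "ennreal (\<integral>x. norm (g n x) \<partial>lebesgue) = I (n + N)" for n
    using nn_integral_eq_integral[OF int, of n] g0 by (simp add: gI)
  moreover have "(\<lambda>n. I (n + N)) \<longlonglongrightarrow> 0" using I by (rule LIMSEQ_ignore_initial_segment)
  ultimately have "(\<lambda>n. ennreal (\<integral>x. norm (g n x) \<partial>lebesgue)) \<longlonglongrightarrow> ennreal 0" by simp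
  then have "(\<lambda>n. \<integral>x. norm (g n x) \<partial>lebesgue) \<longlonglongrightarrow> 0"
    by (subst (asm) tendsto_ennreal_iff) auto
  from tendsto_L1_AE_subseq[OF int this] obtain \<rho> where \<rho>: "strict_mono \<rho>"
    and ae: "AE x in lebesgue. (\<lambda>n. g (\<rho> n) x) \<longlonglongrightarrow> 0" by blast
  have "strict_mono (\<lambda>n. \<rho> n + N)" using \<rho> by (simp add: strict_mono_def)
  moreover have "AE x in lebesgue. (\<lambda>n. \<phi> (\<rho> n + N) x) \<longlonglongrightarrow> u x"
    using ae
  proof eventually_elim
    fix x assume "(\<lambda>n. g (\<rho> n) x) \<longlonglongrightarrow> 0"
    from tendsto_real_sqrt[OF this] have lim: "(\<lambda>n. sqrt (g (\<rho> n) x)) \<longlonglongrightarrow> 0" by simp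
    have "norm (\<phi> (\<rho> n + N) x - u x) \<le> sqrt (g (\<rho> n) x)" for n
    proof -
      have "(\<phi> (\<rho> n + N) x - u x)\<^sup>2 \<le> g (\<rho> n) x"
        unfolding g_def using w0_ge_1[of x] by (simp add: mult_le_cancel_left1)
      from real_sqrt_le_mono[OF this] show ?thesis by simp
    qed
    then have "(\<lambda>n. \<phi> (\<rho> n + N) x - u x) \<longlonglongrightarrow> 0"
      by (intro Lim_null_comparison[OF _ lim] always_eventually allI)
    then show "(\<lambda>n. \<phi> (\<rho> n + N) x) \<longlonglongrightarrow> u x" by (simp add: LIM_zero_iff)
  qed
  ultimately show ?thesis by (intro exI[of _ "\<lambda>n. \<rho> n + N"]) simp
qed

text \<open>
Fatou's lemma along an almost everywhere convergent subsequence of the approximants, whose squared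
norms are eventually below $11/10$.
\<close>

theorem trudinger_moser_H1:
  assumes u: "u \<in> H1_w0" and N: "H1_w0_norm u \<le> 1"
  shows "(\<integral>\<^sup>+x. ennreal ((exp (2 * pi * (u x)\<^sup>2) - 1) * w0 x) \<partial>lebesgue) \<le> ennreal TM_bound"
proof -
  from u obtain \<phi> where m: "u \<in> borel_measurable lebesgue" and \<phi>: "w0_approx \<phi> u"
    by (auto simp: H1_w0_def)
  have c\<phi>: "\<phi> n \<in> Cc_infinity" for n using \<phi> by (simp add: w0_approx_def w0_Cauchy_def)
  have [measurable]: "\<phi> n \<in> borel_measurable lebesgue" for n
    using borel_measurable_Cc[OF c\<phi>] by (intro measurable_completion) simp
  have [measurable]: "w0 \<in> borel_measurable lebesgue" by (intro measurable_completion) simp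
  obtain \<rho> :: "nat \<Rightarrow> nat" where \<rho>: "strict_mono \<rho>"
    and ae: "AE x in lebesgue. (\<lambda>n. \<phi> (\<rho> n) x) \<longlonglongrightarrow> u x"
    using w0_approx_AE_subseq[OF m \<phi>] by blast
  let ?h = "\<lambda>t x. ennreal ((exp (2 * pi * t\<^sup>2) - 1) * w0 x)"
  have "(\<lambda>n. w0_norm (\<phi> (\<rho> n))) \<longlonglongrightarrow> H1_w0_norm u"
    using LIMSEQ_subseq_LIMSEQ[OF H1_w0_norm_tendsto[OF m \<phi>] \<rho>] by (simp add: o_def)
  then have "(\<lambda>n. (w0_norm (\<phi> (\<rho> n)))\<^sup>2) \<longlonglongrightarrow> (H1_w0_norm u)\<^sup>2" by (rule tendsto_power)
  moreover have "(H1_w0_norm u)\<^sup>2 < 11/10"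
    using power_mono[OF N H1_w0_norm_nonneg[OF u], of 2] by simp
  ultimately have ev: "\<forall>\<^sub>F n in sequentially. (w0_norm (\<phi> (\<rho> n)))\<^sup>2 < 11/10" by (rule order_tendstoD(2))
  have "(\<integral>\<^sup>+x. ?h (u x) x \<partial>lebesgue) = (\<integral>\<^sup>+x. liminf (\<lambda>n. ?h (\<phi> (\<rho> n) x) x) \<partial>lebesgue)"
  proof (rule nn_integral_cong_AE, use ae in eventually_elim)
    fix x assume "(\<lambda>n. \<phi> (\<rho> n) x) \<longlonglongrightarrow> u x"
    then have "(\<lambda>n. ?h (\<phi> (\<rho> n) x) x) \<longlonglongrightarrow> ?h (u x) x" by (intro tendsto_intros)
    then show "?h (u x) x = liminf (\<lambda>n. ?h (\<phi> (\<rho> n) x) x)" by (intro lim_imp_Liminf[symmetric]) simp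
  qed
  also have "\<dots> \<le> liminf (\<lambda>n. \<integral>\<^sup>+x. ?h (\<phi> (\<rho> n) x) x \<partial>lebesgue)"
    by (rule nn_integral_liminf) measurable
  also have "\<dots> \<le> liminf (\<lambda>n::nat. ennreal TM_bound)"
  proof (rule Liminf_mono, use ev in eventually_elim)
    fix n assume "(w0_norm (\<phi> (\<rho> n)))\<^sup>2 < 11/10"
    then show "(\<integral>\<^sup>+x. ?h (\<phi> (\<rho> n) x) x \<partial>lebesgue) \<le> ennreal TM_bound"
      unfolding nn_integral_completion by (intro trudinger_moser_Cc c\<phi>) simp
  qed
  also have "\<dots> = ennreal TM_bound" by (rule Liminf_const) simp
  finally show ?thesis .
qed

lemma Cc_bounded:
  assumes \<phi>: "\<phi> \<in> Cc_infinity"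
  obtains B where "\<And>x. (\<phi> x)\<^sup>2 \<le> B"
proof -
  let ?K = "closure {x. \<phi> x \<noteq> 0}"
  have "compact (\<phi> ` ?K)"
    using \<phi> continuous_on_subset[OF Cc_continuous[OF \<phi>]]
    by (intro compact_continuous_image) (auto simp: Cc_infinity_def simp del: compact_closure)
  then obtain b where b: "\<And>y. y \<in> \<phi> ` ?K \<Longrightarrow> norm y \<le> b" "0 < b"
    using bounded_pos compact_imp_bounded by metis
  have "\<bar>\<phi> x\<bar> \<le> b" for x
  proof (cases "\<phi> x = 0")
    case False
    then have "x \<in> ?K" using closure_subset[of "{x. \<phi> x \<noteq> 0}"] by blast
    then show ?thesis using b(1)[of "\<phi> x"] by auto
  qed (use b in simp)
  then have "(\<phi> x)\<^sup>2 \<le> b\<^sup>2" for x using power_mono[of "\<bar>\<phi> x\<bar>" b 2] by simp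
  then show ?thesis by (rule that)
qed

text \<open>
Write $u = \psi + sv$ with $\psi$ smooth of compact support, hence bounded, and $v$ in the unit ball; by
density this is possible for every $s > 0$. With $\alpha s^2 = \pi$ one has
$\alpha u^2 \le 2\alpha\psi^2 + 2\pi v^2$, and the uniform bound applies to $v$.
\<close>

theorem exp_integral_finite:
  assumes u: "u \<in> H1_w0" and \<alpha>: "0 < \<alpha>"
  shows "(\<integral>\<^sup>+x. ennreal ((exp (\<alpha> * (u x)\<^sup>2) - 1) * w0 x) \<partial>lebesgue) < \<infinity>"
proof -
  from u obtain \<phi> where m: "u \<in> borel_measurable lebesgue" and \<phi>: "w0_approx \<phi> u"
    by (auto simp: H1_w0_def)
  have c\<phi>: "\<phi> n \<in> Cc_infinity" for n using \<phi> by (simp add: w0_approx_def w0_Cauchy_def)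
  have wm [measurable]: "w0 \<in> borel_measurable lebesgue" by (intro measurable_completion) simp
  have w: "0 \<le> w0 x" for x using w0_ge_1[of x] by simp
  define s where "s = sqrt (pi / \<alpha>)"
  have s: "0 < s" "\<alpha> * s\<^sup>2 = pi" using \<alpha> by (simp_all add: s_def)
  obtain N where N: "\<And>m n. m \<ge> N \<Longrightarrow> n \<ge> N \<Longrightarrow> w0_norm (\<lambda>x. \<phi> m x - \<phi> n x) < s"
    using \<phi> s(1) unfolding w0_approx_def w0_Cauchy_def by blast
  define \<psi> where "\<psi> = \<phi> N"
  have \<psi>: "\<psi> \<in> Cc_infinity" by (simp add: \<psi>_def c\<phi>)
  have [measurable]: "\<psi> \<in> borel_measurable lebesgue"
    using borel_measurable_Cc[OF \<psi>] by (intro measurable_completion) simp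
  define v where "v x = 1 / s * (u x - \<psi> x)" for x
  have [measurable]: "v \<in> borel_measurable lebesgue" unfolding v_def using m by measurable
  have v: "v \<in> H1_w0" unfolding v_def using H1_w0_affine(1)[OF m \<phi> \<psi>] .
  have "H1_w0_norm v \<le> 1"
    unfolding v_def
  proof (rule LIMSEQ_le_const2[OF H1_w0_affine(2)[OF m \<phi> \<psi>]], intro exI[of _ N] allI impI)
    fix n assume "N \<le> n"
    then show "\<bar>1 / s\<bar> * w0_norm (\<lambda>x. \<phi> n x - \<psi> x) \<le> 1"
      using N[of n N] s by (simp add: \<psi>_def field_simps)
  qed
  note TM = trudinger_moser_H1[OF v this]
  obtain B where B: "\<And>x. (\<psi> x)\<^sup>2 \<le> B" using Cc_bounded[OF \<psi>] by blast
  define A where "A = exp (2 * \<alpha> * B)"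
  have point: "exp (\<alpha> * (u x)\<^sup>2) - 1 \<le> A * (exp (2 * pi * (v x)\<^sup>2) - 1) + 2 * \<alpha> * A * (\<psi> x)\<^sup>2" for x
  proof -
    let ?p = "2 * \<alpha> * (\<psi> x)\<^sup>2" and ?q = "2 * pi * (v x)\<^sup>2"
    have ux: "u x = \<psi> x + s * v x" using s by (simp add: v_def)
    have "(u x)\<^sup>2 \<le> 2 * (\<psi> x)\<^sup>2 + 2 * (s * v x)\<^sup>2"
      unfolding ux using zero_le_power2[of "\<psi> x - s * v x"] by (simp add: power2_eq_square algebra_simps)
    from mult_left_mono[OF this, of \<alpha>] have "\<alpha> * (u x)\<^sup>2 \<le> ?p + 2 * (\<alpha> * s\<^sup>2) * (v x)\<^sup>2"
      using \<alpha> by (simp add: algebra_simps power_mult_distrib)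
    then have "exp (\<alpha> * (u x)\<^sup>2) \<le> exp (?p + ?q)" by (simp add: s(2))
    then have "exp (\<alpha> * (u x)\<^sup>2) - 1 \<le> exp ?p * (exp ?q - 1) + (exp ?p - 1)"
      by (simp add: exp_add algebra_simps)
    also have "\<dots> \<le> exp ?p * (exp ?q - 1) + ?p * exp ?p" by (intro add_left_mono exp_minus_1_le)
    also have "\<dots> \<le> A * (exp ?q - 1) + ?p * A"
    proof -
      have "exp ?p \<le> A" unfolding A_def using B[of x] \<alpha> by simp
      then show ?thesis using \<alpha> by (intro add_mono mult_right_mono mult_left_mono) auto
    qed
    finally show ?thesis by (simp add: mult.commute mult.left_commute)
  qed
  have A: "0 \<le> A" by (simp add: A_def)
  have "(\<integral>\<^sup>+x. ennreal ((exp (\<alpha> * (u x)\<^sup>2) - 1) * w0 x) \<partial>lebesgue) \<le>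
    (\<integral>\<^sup>+x. ennreal A * ennreal ((exp (2 * pi * (v x)\<^sup>2) - 1) * w0 x) + ennreal (2 * \<alpha> * A) * ennreal (\<psi> x * \<psi> x * w0 x) \<partial>lebesgue)"
  proof (rule nn_integral_mono)
    fix x
    have nn: "0 \<le> (exp (2 * pi * (v x)\<^sup>2) - 1) * w0 x" "0 \<le> \<psi> x * \<psi> x * w0 x"
      using mult_nonneg_nonneg[OF _ w] by auto
    have "(exp (\<alpha> * (u x)\<^sup>2) - 1) * w0 x \<le> A * ((exp (2 * pi * (v x)\<^sup>2) - 1) * w0 x) + 2 * \<alpha> * A * (\<psi> x * \<psi> x * w0 x)"
      using mult_right_mono[OF point w[of x]] by (simp add: power2_eq_square algebra_simps)
    then show "ennreal ((exp (\<alpha> * (u x)\<^sup>2) - 1) * w0 x) \<le>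
      ennreal A * ennreal ((exp (2 * pi * (v x)\<^sup>2) - 1) * w0 x) + ennreal (2 * \<alpha> * A) * ennreal (\<psi> x * \<psi> x * w0 x)"
      using A \<alpha> nn by (simp only: ennreal_mult[symmetric] ennreal_plus[symmetric] mult_nonneg_nonneg less_imp_le zero_le_numeral)
        (rule ennreal_leI)
  qed
  also have "\<dots> = ennreal A * (\<integral>\<^sup>+x. ennreal ((exp (2 * pi * (v x)\<^sup>2) - 1) * w0 x) \<partial>lebesgue)
      + ennreal (2 * \<alpha> * A) * (\<integral>\<^sup>+x. ennreal (\<psi> x * \<psi> x * w0 x) \<partial>lebesgue)"
    by (subst nn_integral_add) (simp_all add: nn_integral_cmult)
  also have "\<dots> < \<infinity>"
    using TM by (auto simp: nn_integral_completion nn_integral_w0_prod[OF \<psi>] ennreal_mult_less_top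
        intro: le_less_trans)
  finally show ?thesis .
qed

section \<open>The embedding into the Orlicz space\<close>

lemma exp_minus_1_div:
  fixes t K :: real assumes "1 \<le> K"
  shows "exp (t / K) - 1 \<le> (exp t - 1) / K"
proof -
  have "exp ((1 - 1 / K) *\<^sub>R 0 + (1 / K) *\<^sub>R t) \<le> (1 - 1 / K) * exp 0 + (1 / K) * exp t"
    using assms by (intro convex_onD[OF exp_convex]) auto
  then show ?thesis by (simp add: diff_divide_distrib)
qed

text \<open>
Dividing $u$ by \<open>s\<close> brings it into the unit ball, where the integral is at most the constant
$K$ = \<open>TM_bound\<close>. Dividing the exponent by $K \ge 1$ divides the integral by at least $K$, by
convexity of the exponential function.
\<close>

lemma orlicz_modular_le_1:
  assumes u: "u \<in> H1_w0" and s: "0 < s" "H1_w0_norm u \<le> s"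
  shows "(\<integral>\<^sup>+x. ennreal (exp ((\<bar>u x\<bar> / (s * sqrt (TM_bound / (2 * pi))))\<^sup>2) - 1) \<partial>w0_measure) \<le> 1"
proof -
  let ?K = "TM_bound"
  have K: "1 \<le> ?K" by (rule TM_bound_ge_1)
  have [measurable]: "u \<in> borel_measurable lebesgue" using u by (simp add: H1_w0_def)
  have [measurable]: "w0 \<in> borel_measurable lebesgue" by (intro measurable_completion) simp
  have w: "0 \<le> w0 x" for x using w0_ge_1[of x] by simp
  define v where "v x = 1 / s * u x" for x
  have [measurable]: "v \<in> borel_measurable lebesgue" unfolding v_def by measurable
  have v: "v \<in> H1_w0" "H1_w0_norm v \<le> 1"
    using H1_w0_cmult[OF u, of "1 / s"] s by (simp_all add: v_def[abs_def])
  have "(\<integral>\<^sup>+x. ennreal (exp ((\<bar>u x\<bar> / (s * sqrt (?K / (2 * pi))))\<^sup>2) - 1) \<partial>w0_measure)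
    = (\<integral>\<^sup>+x. ennreal (w0 x) * ennreal (exp ((\<bar>u x\<bar> / (s * sqrt (?K / (2 * pi))))\<^sup>2) - 1) \<partial>lebesgue)"
    unfolding w0_measure_def by (rule nn_integral_density) measurable
  also have "\<dots> \<le> (\<integral>\<^sup>+x. ennreal (1 / ?K) * ennreal ((exp (2 * pi * (v x)\<^sup>2) - 1) * w0 x) \<partial>lebesgue)"
  proof (rule nn_integral_mono)
    fix x
    have "(\<bar>u x\<bar> / (s * sqrt (?K / (2 * pi))))\<^sup>2 = 2 * pi * (v x)\<^sup>2 / ?K"
      using K by (simp add: v_def power_divide power_mult_distrib)
    then have "exp ((\<bar>u x\<bar> / (s * sqrt (?K / (2 * pi))))\<^sup>2) - 1 \<le> (exp (2 * pi * (v x)\<^sup>2) - 1) / ?K"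
      using exp_minus_1_div[OF K] by simp
    from mult_left_mono[OF this w[of x]]
    have "w0 x * (exp ((\<bar>u x\<bar> / (s * sqrt (?K / (2 * pi))))\<^sup>2) - 1) \<le> 1 / ?K * ((exp (2 * pi * (v x)\<^sup>2) - 1) * w0 x)"
      by (simp add: mult.commute)
    then show "ennreal (w0 x) * ennreal (exp ((\<bar>u x\<bar> / (s * sqrt (?K / (2 * pi))))\<^sup>2) - 1)
      \<le> ennreal (1 / ?K) * ennreal ((exp (2 * pi * (v x)\<^sup>2) - 1) * w0 x)"
      using K w by (subst (1 2) ennreal_mult'[symmetric]) (auto intro: ennreal_leI)
  qed
  also have "\<dots> = ennreal (1 / ?K) * (\<integral>\<^sup>+x. ennreal ((exp (2 * pi * (v x)\<^sup>2) - 1) * w0 x) \<partial>lebesgue)"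
    by (rule nn_integral_cmult) measurable
  also have "\<dots> \<le> ennreal (1 / ?K) * ennreal ?K"
    by (intro mult_left_mono trudinger_moser_H1 v) simp
  also have "\<dots> = 1" using K by (simp add: ennreal_mult[symmetric])
  finally show ?thesis .
qed

theorem theorem1p1:
  shows "H1_w0 \<subseteq> orlicz_space (\<lambda>t. exp (t\<^sup>2) - 1) w0_measure
      \<and> (\<exists>C. \<forall>u\<in>H1_w0.
            orlicz_norm (\<lambda>t. exp (t\<^sup>2) - 1) w0_measure u \<le> C * H1_w0_norm u)
      \<and> (\<forall>u\<in>H1_w0. \<forall>\<alpha>>0.
            (\<integral>\<^sup>+x. ennreal ((exp (\<alpha> * (u x)\<^sup>2) - 1) * ln (exp 1 + norm x)) \<partial>lebesgue) < \<infinity>)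
      \<and> (SUP u\<in>{u \<in> H1_w0. (H1_w0_norm u)\<^sup>2 \<le> 1}.
            \<integral>\<^sup>+x. ennreal ((exp (2 * pi * (u x)\<^sup>2) - 1) * ln (exp 1 + norm x)) \<partial>lebesgue) < \<infinity>"
proof (intro conjI)
  let ?c = "sqrt (TM_bound / (2 * pi))"
  have c: "0 < ?c" using TM_bound_ge_1 by simp
  show "H1_w0 \<subseteq> orlicz_space (\<lambda>t. exp (t\<^sup>2) - 1) w0_measure"
  proof
    fix u assume u: "u \<in> H1_w0"
    let ?s = "H1_w0_norm u + 1"
    have s: "0 < ?s" using H1_w0_norm_nonneg[OF u] by simp
    have "u \<in> borel_measurable w0_measure" using u by (simp add: H1_w0_def w0_measure_def)
    moreover have "(\<integral>\<^sup>+x. ennreal (exp ((\<bar>u x\<bar> / (?s * ?c))\<^sup>2) - 1) \<partial>w0_measure) < \<infinity>"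
      using orlicz_modular_le_1[OF u s] by (simp add: le_less_trans)
    moreover have "0 < ?s * ?c" using s c by simp
    ultimately show "u \<in> orlicz_space (\<lambda>t. exp (t\<^sup>2) - 1) w0_measure"
      unfolding orlicz_space_def by blast
  qed
  show "\<exists>C. \<forall>u\<in>H1_w0. orlicz_norm (\<lambda>t. exp (t\<^sup>2) - 1) w0_measure u \<le> C * H1_w0_norm u"
  proof (intro exI[of _ ?c] ballI)
    fix u assume u: "u \<in> H1_w0"
    let ?S = "{k. k > 0 \<and> (\<integral>\<^sup>+x. ennreal (exp ((\<bar>u x\<bar> / k)\<^sup>2) - 1) \<partial>w0_measure) \<le> 1}"
    \<comment> \<open>comparison with every $s$ above the norm covers norm $0$ as well\<close>
    have "Inf ?S / ?c \<le> s" if s: "H1_w0_norm u < s" for s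
    proof -
      have s0: "0 < s" using s H1_w0_norm_nonneg[OF u] by simp
      have "s * ?c \<in> ?S" using orlicz_modular_le_1[OF u s0] s s0 c by simp
      then have "Inf ?S \<le> s * ?c" by (rule cInf_lower) (auto intro!: bdd_belowI[of _ 0])
      then show ?thesis using c by (simp add: divide_le_eq)
    qed
    then have "Inf ?S / ?c \<le> H1_w0_norm u" by (rule dense_ge)
    then show "orlicz_norm (\<lambda>t. exp (t\<^sup>2) - 1) w0_measure u \<le> ?c * H1_w0_norm u"
      unfolding orlicz_norm_def using c by (simp add: divide_le_eq mult.commute)
  qed
  show "\<forall>u\<in>H1_w0. \<forall>\<alpha>>0.
      (\<integral>\<^sup>+x. ennreal ((exp (\<alpha> * (u x)\<^sup>2) - 1) * ln (exp 1 + norm x)) \<partial>lebesgue) < \<infinity>"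
    using exp_integral_finite unfolding w0_def by blast
  have "(SUP u\<in>{u \<in> H1_w0. (H1_w0_norm u)\<^sup>2 \<le> 1}.
      \<integral>\<^sup>+x. ennreal ((exp (2 * pi * (u x)\<^sup>2) - 1) * ln (exp 1 + norm x)) \<partial>lebesgue) \<le> ennreal TM_bound"
  proof (rule SUP_least)
    fix u assume "u \<in> {u \<in> H1_w0. (H1_w0_norm u)\<^sup>2 \<le> 1}"
    then have "u \<in> H1_w0" "H1_w0_norm u \<le> 1" by (auto simp: abs_le_square_iff[of _ 1, simplified, symmetric])
    from trudinger_moser_H1[OF this]
    show "(\<integral>\<^sup>+x. ennreal ((exp (2 * pi * (u x)\<^sup>2) - 1) * ln (exp 1 + norm x)) \<partial>lebesgue) \<le> ennreal TM_bound"
      by (simp add: w0_def)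
  qed
  then show "(SUP u\<in>{u \<in> H1_w0. (H1_w0_norm u)\<^sup>2 \<le> 1}.
      \<integral>\<^sup>+x. ennreal ((exp (2 * pi * (u x)\<^sup>2) - 1) * ln (exp 1 + norm x)) \<partial>lebesgue) < \<infinity>"
    by (rule le_less_trans) simp
qed

end
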